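(* Let $n,d\in\mathbb{N}$ and let $n$ be even. Let $\gamma=\gamma_{d,n}:[0,1]\to\mathbb{T}^d$ be the curve $\gamma(y)=\left(y,(2n+1)y,\dots,(2n+1)^{d-1}y\right)\bmod 1$. Then $\gamma$ is quasi-optimal in the following sense. (i) It integrates every $f\in\Pi_n^d$ exactly, i.e. $\frac{1}{\ell(\gamma)}\int_\gamma f\,\mathrm{d}\sigma=\int_{\mathbb{T}^d}f(x)\,\mathrm{d}x$, and its exact geometric quantities, namely the covering radius $\delta$ of its trajectory and its length $\ell(\gamma)$, satisfy $$\delta\ge\frac14\cdot\frac{1}{n+1},\qquad \ell(\gamma)\le\frac{3}{\sqrt8}\cdot(2n+1)^{d-1}.$$ (ii) These quantities are thus within a dimension-dependent multiple of the following necessary bounds: every quadrature rule $\sum_jw_jf(x_j)$ with finitely many points $x_j\in\mathbb{T}^d$ and positive weights $w_j>0$ that is exact for all $f\in\Pi_n^d$ has covering radius $$\delta\le2^{d-1}\cdot\frac{1}{n+1},$$ and every continuous, piecewise differentiable closed curve $\eta:[0,1]\to\mathbb{T}^d$ with at most finitely many self-intersections and covering radius at most $1/8$, for which there is a non-negative weight function $w$ on its trajectory with $\frac{1}{\ell(\eta)}\int_\eta f(x)w(x)\,\mathrm{d}\sigma(x)=\int_{\mathbb{T}^d}f(x)\,\mathrm{d}x$ for all $f\in\Pi_n^d$, has length $$\ell(\eta)\ge\frac{0.94}{\sqrt{2d+1}}\cdot(n+1)^{d-1}.$$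
   Context: $\mathbb{N}=\{1,2,\dots\}$. $\mathbb{T}^d\simeq[0,1)^d$ is the $d$-dimensional torus (unit cube with opposing sides identified) with Lebesgue measure $\mathrm{d}x$; "mod 1" is componentwise. $\Pi_n^d$ is the space of trigonometric polynomials $f(x)=\sum_{k\in\mathbb{Z}^d,\ \|k\|_\infty\le n}c_k\,\mathrm{e}^{2\pi i k\cdot x}$, $c_k\in\mathbb{C}$. A quadrature rule is exact for $f$ if its value equals $\int_{\mathbb{T}^d}f(x)\,\mathrm{d}x$. The covering radius of a set $Y\subset\mathbb{T}^d$ (a finite set of quadrature points, or the trajectory of a curve) is $\delta_Y=\sup_{x\in\mathbb{T}^d}\inf_{y\in Y}|y-x|_\infty$ with $|x-y|_\infty=\inf_{z\in\mathbb{Z}^d}\|x-y+z\|_\infty$. Integration along a curve is with respect to arc length, $\int_\gamma g\,\mathrm{d}\sigma=\int_0^1g(\gamma(t))\|\dot\gamma(t)\|_2\,\mathrm{d}t$, and the length is $\ell(\gamma)=\int_0^1\|\dot\gamma(t)\|_2\,\mathrm{d}t$.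
   Formalization: The lower bound on the covering radius δ of γ, and the claim that δ is within a dimension-dependent multiple of the necessary bound, are stated only for d ≥ 2; for d = 1 the curve γ(y) = y mod 1 covers the whole torus, so δ = 0 and both fail. *)

theory Defs
  imports "HOL-Analysis.Analysis"
begin

text \<open>
  The torus is represented by the fundamental domain \<open>[0,1)\<^sup>d\<close>, where \<open>d\<close> is the cardinality of the
  index type. The subspace topology of this cube is not the topology of the torus, so continuity
  and differentiability of curves are expressed through the distance \<open>torus_dist\<close> below.
\<close>

definition torus :: "(real ^ 'd) set" where
  "torus = {x. \<forall>i. 0 \<le> x $ i \<and> x $ i < 1}"

definition torus_dist :: "real ^ 'd \<Rightarrow> real ^ 'd \<Rightarrow> real" where
  "torus_dist x y = (INF z\<in>{z. \<forall>i. z $ i \<in> \<int>}. infnorm (x - y + z))"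

definition covering_radius :: "(real ^ 'd) set \<Rightarrow> real" where
  "covering_radius Y = (SUP x\<in>torus. INF y\<in>Y. torus_dist y x)"

definition trig_polys :: "nat \<Rightarrow> (real ^ 'd \<Rightarrow> complex) set" where
  "trig_polys n = {f. \<exists>c :: int ^ 'd \<Rightarrow> complex. f = (\<lambda>x.
     \<Sum>k | \<forall>i. \<bar>k $ i\<bar> \<le> int n.
       c k * exp (2 * of_real pi * \<i> * of_real (\<Sum>i\<in>UNIV. of_int (k $ i) * x $ i)))}"

lemma finite_frequencies: "finite {k :: int ^ 'd. \<forall>i. \<bar>k $ i\<bar> \<le> int n}"
proof (rule finite_subset)
  show "{k :: int ^ 'd. \<forall>i. \<bar>k $ i\<bar> \<le> int n} \<subseteq> vec_lambda ` (UNIV \<rightarrow>\<^sub>E {- int n..int n})"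
  proof
    fix k :: "int ^ 'd"
    assume "k \<in> {k. \<forall>i. \<bar>k $ i\<bar> \<le> int n}"
    then have "vec_nth k \<in> UNIV \<rightarrow>\<^sub>E {- int n..int n}"
      by (auto simp: abs_le_iff minus_le_iff)
    then show "k \<in> vec_lambda ` (UNIV \<rightarrow>\<^sub>E {- int n..int n})"
      by (metis imageI vec_nth_inverse)
  qed
qed (simp add: finite_PiE)

definition torus_integral :: "(real ^ 'd \<Rightarrow> complex) \<Rightarrow> complex" where
  "torus_integral f = (LINT x:torus|lebesgue. f x)"

definition torus_continuous :: "(real \<Rightarrow> real ^ 'd) \<Rightarrow> bool" where
  "torus_continuous g \<longleftrightarrow>
     (\<forall>t\<in>{0..1}. ((\<lambda>s. torus_dist (g s) (g t)) \<longlongrightarrow> 0) (at t within {0..1}))"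

text \<open>The derivative is the usual one read modulo 1: \<open>g s = g t + (s - t) v + o(s - t)\<close>.\<close>

definition has_torus_derivative :: "(real \<Rightarrow> real ^ 'd) \<Rightarrow> real ^ 'd \<Rightarrow> real \<Rightarrow> bool" where
  "has_torus_derivative g v t \<longleftrightarrow>
     ((\<lambda>s. torus_dist (g s) (g t + (s - t) *\<^sub>R v) / \<bar>s - t\<bar>) \<longlongrightarrow> 0) (at t within {0..1})"

definition torus_velocity :: "(real \<Rightarrow> real ^ 'd) \<Rightarrow> real \<Rightarrow> real ^ 'd" where
  "torus_velocity g t = (SOME v. has_torus_derivative g v t)"

definition torus_piecewise_differentiable :: "(real \<Rightarrow> real ^ 'd) \<Rightarrow> bool" where
  "torus_piecewise_differentiable g \<longleftrightarrow>
     (\<exists>S. finite S \<and> (\<forall>t\<in>{0..1} - S. \<exists>v. has_torus_derivative g v t))"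

definition self_intersections :: "(real \<Rightarrow> real ^ 'd) \<Rightarrow> (real ^ 'd) set" where
  "self_intersections g = {x. \<exists>s\<in>{0..<1}. \<exists>t\<in>{0..<1}. s \<noteq> t \<and> g s = x \<and> g t = x}"

text \<open>
  The Euclidean speed is \<open>norm\<close>; distances on the torus use the maximum norm.
  If the speed is not integrable, \<open>curve_length\<close> is 0. Such a curve, and likewise a weight \<open>w\<close> for
  which \<open>w\<close> times the speed is not integrable, never satisfies the exactness condition below,
  because for \<open>f = 1\<close> its left-hand side is then 0.
\<close>

definition curve_length :: "(real \<Rightarrow> real ^ 'd) \<Rightarrow> real" where
  "curve_length g = (LINT t:{0..1}|lebesgue. norm (torus_velocity g t))"

definition curve_integral :: "(real \<Rightarrow> real ^ 'd) \<Rightarrow> (real ^ 'd \<Rightarrow> complex) \<Rightarrow> complex" where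
  "curve_integral g f =
     (LINT t:{0..1}|lebesgue. f (g t) * of_real (norm (torus_velocity g t)))"

definition curve_exact :: "nat \<Rightarrow> (real \<Rightarrow> real ^ 'd) \<Rightarrow> (real ^ 'd \<Rightarrow> real) \<Rightarrow> bool" where
  "curve_exact n g w \<longleftrightarrow> (\<forall>f\<in>trig_polys n.
     1 / of_real (curve_length g) * curve_integral g (\<lambda>x. f x * of_real (w x)) = torus_integral f)"

definition quadrature_exact ::
    "nat \<Rightarrow> nat \<Rightarrow> (nat \<Rightarrow> real ^ 'd) \<Rightarrow> (nat \<Rightarrow> real) \<Rightarrow> bool" where
  "quadrature_exact n N x w \<longleftrightarrow> (\<forall>f\<in>trig_polys n.
     (\<Sum>j<N. of_real (w j) * f (x j)) = torus_integral f)"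

text \<open>
  The linear order on the index type numbers the coordinates, and \<open>card {j. j < i}\<close> is the position
  of \<open>i\<close>, counted from 0. For \<open>d = 1\<close> the curve runs through the whole torus, so its covering radius
  is 0; lower bounds for the covering radius therefore require \<open>d \<ge> 2\<close>.
\<close>

definition gamma_curve :: "nat \<Rightarrow> real \<Rightarrow> real ^ 'd::{finite, linorder}" where
  "gamma_curve n y = (\<chi> i. frac ((2 * real n + 1) ^ card {j. j < i} * y))"

end

theory Submission
  imports Defs
begin

text \<open>
  A curve along which \<open>\<Pi>\<^sub>n\<close> is integrated exactly must be long because positivity tests it against
  nonnegative kernels. Let \<open>P\<close> be the product of normalised one-dimensional Fejer kernels of degree
  \<open>n\<close>; it has mean \<open>(n+1)\<^bsup>-d\<^esup>\<close> and \<open>P x \<ge> 1 - (\<pi>(n+1)\<bar>x\<bar>)\<^sup>2/3\<close>. The average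
  \<open>F y = \<integral>\<^sub>\<eta> P (y - x) d\<sigma>(x)\<close> lies in \<open>\<Pi>\<^sub>n\<close> and has mean \<open>\<ell>(\<eta>) (n+1)\<^bsup>-d\<^esup>\<close>. On the curve itself \<open>F\<close> is at least
  \<open>2/3 \<cdot> 2/(\<pi>(n+1))\<close>, since the arc of length \<open>1/(\<pi>(n+1))\<close> to either side of \<open>y\<close> stays within this distance
  of \<open>y\<close>. Exactness applied to \<open>F\<close> gives \<open>\<ell>(\<eta>) \<ge> 4/(3\<pi>) (n+1)\<^bsup>d-1\<^esup>\<close>, which suffices for \<open>d \<ge> 2\<close>; for
  \<open>d = 1\<close> the covering radius alone forces \<open>\<ell>(\<eta>) \<ge> 3/4\<close>.

  For point quadrature the test polynomial is \<open>(\<Sum>\<^sub>i cos (2\<pi>x\<^sub>i) - (d - 1) - cos (2\<pi>r)) Q x\<close> with a product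
  kernel \<open>Q \<ge> 0\<close>: it is nonpositive outside the cube of radius \<open>r\<close> around the origin, and if the
  coefficients of \<open>Q\<close> are chosen to maximise the first Fourier coefficient, its integral is positive for
  \<open>r = 2\<^bsup>d-1\<^esup>/(n+1)\<close>. So every cube of this radius contains a quadrature point.

  The curve \<open>\<gamma>\<close> is exact because the frequency of a character along \<open>\<gamma>\<close> is \<open>\<Sum>\<^sub>i k\<^sub>i (2n+1)\<^sup>i\<close>, whose digits
  satisfy \<open>\<bar>k\<^sub>i\<bar> \<le> n\<close>, so that it vanishes only for \<open>k = 0\<close>.
\<close>

subsection \<open>Distance and covering radius on the torus\<close>

lemma infnorm_le_iff_cart: "infnorm (x :: real ^ 'd) \<le> r \<longleftrightarrow> (\<forall>i. \<bar>x $ i\<bar> \<le> r)"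
proof
  assume "infnorm x \<le> r"
  then show "\<forall>i. \<bar>x $ i\<bar> \<le> r"
    using component_le_infnorm_cart[of x] order_trans by blast
next
  assume "\<forall>i. \<bar>x $ i\<bar> \<le> r"
  then show "infnorm x \<le> r"
    unfolding infnorm_cart by (intro cSup_least) auto
qed

lemma torus_dist_bdd:
  "bdd_below ((\<lambda>z. infnorm (x - y + z)) ` {z :: real ^ 'd. \<forall>i. z $ i \<in> \<int>})"
  by (auto intro!: bdd_belowI[of _ 0] simp: infnorm_pos_le)

lemma torus_dist_le:
  "(\<And>i. z $ i \<in> \<int>) \<Longrightarrow> torus_dist x y \<le> infnorm (x - y + z)"
  unfolding torus_dist_def by (rule cINF_lower[OF torus_dist_bdd]) simp

lemma torus_dist_ge:
  assumes "\<And>z. (\<And>i. z $ i \<in> \<int>) \<Longrightarrow> r \<le> infnorm (x - y + z)"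
  shows "r \<le> torus_dist x y"
proof -
  have "(0 :: real ^ 'a) \<in> {z. \<forall>i. z $ i \<in> \<int>}" by simp
  then show ?thesis
    unfolding torus_dist_def using assms by (intro cINF_greatest) (blast, simp)
qed

lemma torus_dist_nonneg: "0 \<le> torus_dist x y"
  by (rule torus_dist_ge) (rule infnorm_pos_le)

lemma torus_dist_lessE:
  assumes "torus_dist x y < r"
  obtains z where "\<And>i. z $ i \<in> \<int>" "infnorm (x - y + z) < r"
  using assms torus_dist_ge[of r x y] by (meson linorder_not_le)

text \<open>Rounding every coordinate of \<open>x - y\<close> supplies the lattice vector. The bound
  keeps the supremum in \<open>covering_radius\<close> finite and disposes of radii above
  \<open>1/2\<close>.\<close>

lemma torus_dist_le_half: "torus_dist x y \<le> 1/2"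
proof -
  define z where "z = ((\<chi> i. - of_int (round ((x - y) $ i))) :: real ^ 'a)"
  have "torus_dist x y \<le> infnorm (x - y + z)"
    by (rule torus_dist_le) (simp add: z_def)
  also have "\<dots> \<le> 1/2"
    unfolding infnorm_le_iff_cart
  proof
    fix i
    have "\<bar>of_int (round ((x - y) $ i)) - (x - y) $ i\<bar> \<le> 1/2"
      by (rule of_int_round_abs_le)
    then show "\<bar>(x - y + z) $ i\<bar> \<le> 1/2"
      by (simp add: z_def abs_minus_commute)
  qed
  finally show ?thesis .
qed

text \<open>Both summands have the common point \<open>u\<close> in first place, the shape produced
  by \<open>has_torus_derivative\<close>, which spares a separate symmetry law.\<close>

lemma torus_dist_triangle: "torus_dist x y \<le> torus_dist u x + torus_dist u y"
proof (rule field_le_epsilon)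
  fix e :: real assume "e > 0"
  obtain z where z: "\<And>i. z $ i \<in> \<int>" "infnorm (u - x + z) < torus_dist u x + e/2"
    using torus_dist_lessE[of u x "torus_dist u x + e/2"] \<open>e > 0\<close> by auto
  obtain z' where z': "\<And>i. z' $ i \<in> \<int>" "infnorm (u - y + z') < torus_dist u y + e/2"
    using torus_dist_lessE[of u y "torus_dist u y + e/2"] \<open>e > 0\<close> by auto
  have "torus_dist x y \<le> infnorm (x - y + (z' - z))"
    by (rule torus_dist_le) (simp add: z z')
  also have "x - y + (z' - z) = (u - y + z') + - (u - x + z)"
    by simp
  also have "infnorm \<dots> \<le> infnorm (u - y + z') + infnorm (u - x + z)"
    using infnorm_triangle[of "u - y + z'" "- (u - x + z)"] by (simp only: infnorm_neg)
  finally show "torus_dist x y \<le> torus_dist u x + torus_dist u y + e"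
    using z(2) z'(2) by simp
qed

lemma abs_le_abs_add_Ints:
  fixes a z :: real
  assumes "\<bar>a\<bar> \<le> 1/2" "z \<in> \<int>"
  shows "\<bar>a\<bar> \<le> \<bar>a + z\<bar>"
proof (cases "z = 0")
  case False
  then have "\<bar>z\<bar> \<ge> 1" using Ints_nonzero_abs_ge1[OF assms(2)] by simp
  then show ?thesis using assms(1) by linarith
qed simp

text \<open>A difference with entries of modulus at most \<open>1/2\<close> is already a shortest
  representative modulo 1, coordinate by coordinate. So the torus is locally isometric to
  \<open>real ^ 'd\<close> with the maximum norm.\<close>

lemma torus_dist_eq_infnorm:
  assumes "infnorm (x - y) \<le> 1/2"
  shows "torus_dist x y = infnorm (x - y)"
proof (rule antisym)
  show "torus_dist x y \<le> infnorm (x - y)"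
    using torus_dist_le[of 0 x y] by simp
  show "infnorm (x - y) \<le> torus_dist x y"
  proof (rule torus_dist_ge)
    fix z :: "real ^ 'a" assume z: "\<And>i. z $ i \<in> \<int>"
    show "infnorm (x - y) \<le> infnorm (x - y + z)"
      unfolding infnorm_le_iff_cart
    proof
      fix i
      have "\<bar>(x - y) $ i\<bar> \<le> \<bar>(x - y) $ i + z $ i\<bar>"
        using assms z unfolding infnorm_le_iff_cart by (intro abs_le_abs_add_Ints) blast+
      also have "\<dots> \<le> infnorm (x - y + z)"
        using component_le_infnorm_cart[of "x - y + z" i] by simp
      finally show "\<bar>(x - y) $ i\<bar> \<le> infnorm (x - y + z)" .
    qed
  qed
qed

text \<open>Lets a curve in the cube be replaced by an unreduced representative, such as a straight
  line or a continuous lift.\<close>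

lemma torus_dist_cong:
  assumes "\<And>i. (x - x') $ i \<in> \<int>" "\<And>i. (y - y') $ i \<in> \<int>"
  shows "torus_dist x y = torus_dist x' y'"
proof -
  have *: "torus_dist x y \<le> torus_dist x' y'"
    if d: "\<And>i. (x - x') $ i \<in> \<int>" "\<And>i. (y - y') $ i \<in> \<int>" for x y x' y' :: "real ^ 'a"
  proof (rule torus_dist_ge)
    fix z :: "real ^ 'a" assume z: "\<And>i. z $ i \<in> \<int>"
    have "torus_dist x y \<le> infnorm (x - y + (z + (y - y') - (x - x')))"
      by (rule torus_dist_le) (use z d in \<open>simp add: Ints_add Ints_diff\<close>)
    then show "torus_dist x y \<le> infnorm (x' - y' + z)"
      by (simp add: algebra_simps)
  qed
  show ?thesis
    by (rule antisym[OF * *]) (use assms Ints_minus in \<open>fastforce+\<close>)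
qed

lemma covering_radius_le:
  assumes "Y \<noteq> {}" "\<And>x. x \<in> torus \<Longrightarrow> \<exists>y\<in>Y. torus_dist y x \<le> r"
  shows "covering_radius Y \<le> r"
  unfolding covering_radius_def
proof (rule cSUP_least)
  have "0 \<in> torus" by (simp add: torus_def)
  then show "torus \<noteq> {}" by blast
next
  fix x :: "real ^ 'a" assume "x \<in> torus"
  then obtain y where y: "y \<in> Y" "torus_dist y x \<le> r" using assms(2) by blast
  have "(INF y\<in>Y. torus_dist y x) \<le> torus_dist y x"
    by (rule cINF_lower[OF _ y(1)]) (auto intro!: bdd_belowI[of _ 0] simp: torus_dist_nonneg)
  with y(2) show "(INF y\<in>Y. torus_dist y x) \<le> r" by linarith
qed

text \<open>A real-valued supremum dominates its members only when bounded above; the diameter bound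
  \<open>1/2\<close> provides this.\<close>

lemma covering_radius_ge:
  assumes "Y \<noteq> {}" "x \<in> torus" "\<And>y. y \<in> Y \<Longrightarrow> r \<le> torus_dist y x"
  shows "r \<le> covering_radius Y"
proof -
  have "r \<le> (INF y\<in>Y. torus_dist y x)"
    using assms by (intro cINF_greatest) auto
  also have "\<dots> \<le> covering_radius Y"
    unfolding covering_radius_def
  proof (rule cSUP_upper[OF assms(2)], rule bdd_aboveI2)
    fix x :: "real ^ 'a"
    obtain y where "y \<in> Y" using assms(1) by blast
    then have "(INF y\<in>Y. torus_dist y x) \<le> torus_dist y x"
      by (intro cINF_lower) (auto intro!: bdd_belowI[of _ 0] simp: torus_dist_nonneg)
    then show "(INF y\<in>Y. torus_dist y x) \<le> 1/2"
      using torus_dist_le_half[of y x] by linarith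
  qed
  finally show ?thesis .
qed

subsection \<open>Characters\<close>

definition character :: "int ^ 'd \<Rightarrow> real ^ 'd \<Rightarrow> complex" where
  "character k x = cis (2 * pi * (\<Sum>i\<in>UNIV. of_int (k $ i) * x $ i))"

lemma trig_polys_altdef:
  "trig_polys n = {f. \<exists>c. f = (\<lambda>x. \<Sum>k | \<forall>i. \<bar>k $ i\<bar> \<le> int n. c k * character k x)}"
  unfolding trig_polys_def character_def cis_conv_exp by (simp add: mult_ac)

lemma character_add: "character k (x + y) = character k x * character k y"
  unfolding character_def cis_mult by (simp add: sum.distrib algebra_simps)

lemma character_0_left [simp]: "character 0 x = 1"
  by (simp add: character_def)

lemma norm_character [simp]: "norm (character k x) = 1"
  by (simp add: character_def)

lemma cis_sum: "finite A \<Longrightarrow> cis (\<Sum>i\<in>A. f i) = (\<Prod>i\<in>A. cis (f i))"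
  by (induction A rule: finite_induct) (simp_all flip: cis_mult)

lemma character_prod: "character k x = (\<Prod>i\<in>UNIV. cis (2 * pi * of_int (k $ i) * x $ i))"
  unfolding character_def by (simp add: sum_distrib_left cis_sum mult_ac)

lemma character_Ints:
  assumes "\<And>i. x $ i \<in> \<int>"
  shows "character k x = 1"
  unfolding character_def by (intro cis_multiple_2pi Ints_sum Ints_mult) (use assms in auto)

lemma character_cong:
  assumes "\<And>i. (x - y) $ i \<in> \<int>"
  shows "character k x = character k y"
  using character_add[of k "x - y" y] character_Ints[OF assms] by simp

lemma continuous_on_character [continuous_intros]:
  "continuous_on S f \<Longrightarrow> continuous_on S (\<lambda>t. character k (f t))"
  unfolding character_def by (intro continuous_intros) auto

text \<open>For \<open>m \<noteq> 0\<close> the antiderivative \<open>F\<close> takes equal values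
  at 0 and 1. The half-open interval serves the torus, the closed one the parameter of a
  curve.\<close>

lemma integral_cis_lborel:
  "(LBINT t:{0..<1}. cis (2 * pi * of_int m * t)) = of_bool (m = 0)"
  "(LBINT t:{0..1}. cis (2 * pi * of_int m * t)) = of_bool (m = 0)"
proof -
  have "(LBINT t=ereal 0..ereal 1. cis (2 * pi * of_int m * t)) = of_bool (m = 0)"
  proof (cases "m = 0")
    case True
    then show ?thesis by (simp add: interval_integral_Icc set_lebesgue_integral_def)
  next
    case False
    define F where "F = (\<lambda>t. cis (2 * pi * of_int m * t) / (2 * pi * of_int m * \<i>))"
    have "(LBINT t=ereal 0..ereal 1. cis (2 * pi * of_int m * t)) = F 1 - F 0"
    proof (rule interval_integral_FTC_finite)
      show "continuous_on {min 0 1..max 0 1} (\<lambda>t. cis (2 * pi * of_int m * t))"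
        by (intro continuous_intros)
      fix t :: real
      have "(F has_vector_derivative cis (2 * pi * of_int m * t)) (at t)"
      proof -
        define c where "c = 2 * pi * of_int m * \<i>"
        have "((\<lambda>z. exp (c * z) / c) has_field_derivative exp (c * of_real t)) (at (of_real t))"
          using False by (auto intro!: derivative_eq_intros simp: c_def)
        from has_vector_derivative_real_field[OF this, of UNIV] show ?thesis
          by (simp add: F_def c_def cis_conv_exp mult_ac)
      qed
      then show "(F has_vector_derivative cis (2 * pi * of_int m * t)) (at t within {min 0 1..max 0 1})"
        by (rule has_vector_derivative_at_within)
    qed
    also have "\<dots> = 0"
      using cis_multiple_2pi[of "of_int m"] by (simp add: F_def)
    finally show ?thesis using False by simp
  qed
  then show "(LBINT t:{0..<1}. cis (2 * pi * of_int m * t)) = of_bool (m = 0)"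
    "(LBINT t:{0..1}. cis (2 * pi * of_int m * t)) = of_bool (m = 0)"
    using interval_integral_Ico[of 0 1 "\<lambda>t. cis (2 * pi * of_int m * t)"]
      interval_integral_Icc[of 0 1 "\<lambda>t. cis (2 * pi * of_int m * t)"]
    by argo+
qed

lemma prod_Basis_cart:
  "(\<Prod>b\<in>(Basis :: (real ^ 'd) set). f b) = (\<Prod>i\<in>UNIV. f (axis i 1))"
proof -
  have "(Basis :: (real ^ 'd) set) = range (\<lambda>i. axis i 1)"
    by (auto simp: Basis_vec_def)
  then show ?thesis
    by (auto simp: axis_eq_axis inj_on_def intro!: prod.reindex_cong[where l = "\<lambda>i. axis i 1"])
qed

text \<open>Fubini for separated variables. Lebesgue measure on vectors is a product over the
  standard basis, so factors have to be reindexed from basis vectors to coordinates.\<close>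

lemma integral_lborel_prod_cart:
  fixes f :: "'d::finite \<Rightarrow> real \<Rightarrow> complex"
  assumes "\<And>i. integrable lborel (f i)"
  shows "(LBINT x. (\<Prod>i\<in>UNIV. f i (x $ i))) = (\<Prod>i\<in>UNIV. LBINT t. f i t)"
proof -
  interpret product_sigma_finite "\<lambda>_ :: real ^ 'd. lborel :: real measure" ..
  have [measurable]: "f i \<in> borel_measurable borel" for i
    using borel_measurable_integrable[OF assms[of i]] by simp
  \<comment> \<open>\<open>idx\<close> inverts the correspondence between coordinates and basis
    vectors.\<close>
  define idx where "idx b = (THE i. b = axis i (1 :: real))" for b :: "real ^ 'd"
  have idx: "idx (axis i 1) = i" for i
    unfolding idx_def by (auto simp: axis_eq_axis)
  have comp: "(\<Sum>b\<in>Basis. g b *\<^sub>R b) $ i = g (axis i 1)" for g and i :: 'd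
  proof -
    have "(\<Sum>b\<in>Basis. g b *\<^sub>R b) \<bullet> (axis i (1::real)) = g (axis i 1)"
      by (subst inner_sum_left_Basis) auto
    then show ?thesis by (simp add: inner_axis)
  qed
  have "(LBINT x. (\<Prod>i\<in>UNIV. f i (x $ i)))
      = (\<integral>g. (\<Prod>i\<in>UNIV. f i ((\<Sum>b\<in>Basis. g b *\<^sub>R b) $ i)) \<partial>(\<Pi>\<^sub>M b\<in>(Basis :: (real ^ 'd) set). lborel))"
    by (subst lborel_eq, subst integral_distr) auto
  also have "\<dots> = (\<integral>g. (\<Prod>b\<in>Basis. f (idx b) (g b)) \<partial>(\<Pi>\<^sub>M b\<in>(Basis :: (real ^ 'd) set). lborel))"
    by (simp only: comp prod_Basis_cart idx)
  also have "\<dots> = (\<Prod>b\<in>(Basis :: (real ^ 'd) set). LBINT t. f (idx b) t)"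
    by (rule product_integral_prod) (use assms in auto)
  finally show ?thesis by (simp add: prod_Basis_cart idx)
qed

lemma torus_borel [measurable]: "(torus :: (real ^ 'd) set) \<in> sets borel"
proof -
  have "(torus :: (real ^ 'd) set) = (\<Inter>i. {x. 0 \<le> x $ i} \<inter> {x. x $ i < 1})"
    by (auto simp: torus_def)
  also have "\<dots> \<in> sets borel"
    by (intro sets.finite_INT sets.Int borel_closed borel_open closed_Collect_le open_Collect_less
        continuous_intros) auto
  finally show ?thesis .
qed

lemma set_integrable_character: "set_integrable lborel torus (character k)"
proof (rule set_integrable_subset)
  show "set_integrable lborel (cbox 0 1) (character k)"
    unfolding set_integrable_def
    by (intro borel_integrable_compact compact_cbox continuous_intros)
  show "torus \<subseteq> cbox 0 (1 :: real ^ 'a)"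
    by (auto simp: torus_def mem_box_cart less_imp_le)
qed simp

text \<open>Passes from the completed measure of the definition to the Borel measure, for which the
  product formula is stated.\<close>

lemma torus_integral_lborel:
  assumes "set_integrable lborel torus f"
  shows "torus_integral f = (LBINT x:torus. f x)"
  using assms unfolding torus_integral_def set_lebesgue_integral_def set_integrable_def
  by (intro integral_completion) auto

text \<open>Cube and character both factor over the coordinates, so any nonzero \<open>k $ i\<close>
  annihilates the product of one-dimensional integrals.\<close>

lemma torus_integral_character: "torus_integral (character k) = of_bool (k = 0)"
proof -
  have "torus_integral (character k) = (LBINT x:torus. character k x)"
    by (rule torus_integral_lborel[OF set_integrable_character])
  also have "\<dots> = (LBINT x. (\<Prod>i\<in>UNIV. indicator {0..<1} (x $ i) *\<^sub>R cis (2 * pi * of_int (k $ i) * x $ i)))"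
    unfolding set_lebesgue_integral_def
  proof (rule Bochner_Integration.integral_cong[OF refl])
    fix x :: "real ^ 'a"
    have "(indicator torus x :: real) = (\<Prod>i\<in>UNIV. indicator {0..<1} (x $ i))"
    proof (cases "x \<in> torus")
      case False
      then obtain i where "\<not> (0 \<le> x $ i \<and> x $ i < 1)" by (auto simp: torus_def)
      then have "(\<Prod>i\<in>UNIV. indicator {0..<1} (x $ i)) = (0 :: real)"
        by (intro prod_zero) (auto intro!: bexI[of _ i] simp: indicator_def)
      with False show ?thesis by simp
    qed (auto simp: torus_def)
    then show "indicator torus x *\<^sub>R character k x =
        (\<Prod>i\<in>UNIV. indicator {0..<1} (x $ i) *\<^sub>R cis (2 * pi * of_int (k $ i) * x $ i))"
      by (simp add: character_prod scaleR_conv_of_real prod.distrib)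
  qed
  also have "\<dots> = (\<Prod>i\<in>UNIV. LBINT t. indicator {0..<1} t *\<^sub>R cis (2 * pi * of_int (k $ i) * t))"
  proof (rule integral_lborel_prod_cart)
    fix i
    have "set_integrable lborel {0..1} (\<lambda>t. cis (2 * pi * of_int (k $ i) * t))"
      unfolding set_integrable_def by (intro borel_integrable_compact compact_Icc continuous_intros)
    then have "set_integrable lborel {0..<1} (\<lambda>t. cis (2 * pi * of_int (k $ i) * t))"
      by (rule set_integrable_subset) auto
    then show "integrable lborel (\<lambda>t. indicator {0..<1} t *\<^sub>R cis (2 * pi * of_int (k $ i) * t))"
      by (simp add: set_integrable_def)
  qed
  also have "\<dots> = (\<Prod>i\<in>UNIV. of_bool (k $ i = 0))"
    using integral_cis_lborel(1) by (simp add: set_lebesgue_integral_def)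
  also have "\<dots> = of_bool (k = 0)"
  proof (cases "k = 0")
    case False
    then obtain i where "k $ i \<noteq> 0" by (auto simp: vec_eq_iff)
    with False show ?thesis by (auto simp: prod_zero_iff)
  qed simp
  finally show ?thesis .
qed

lemma torus_integral_sum_character:
  assumes "finite K"
  shows "torus_integral (\<lambda>x. \<Sum>k\<in>K. c k * character k x) = (if 0 \<in> K then c 0 else 0)"
proof -
  have int: "set_integrable lborel torus (\<lambda>x. c k * character k x)" for k
    by (intro set_integrable_mult_right set_integrable_character)
  have distr: "indicator torus x *\<^sub>R (\<Sum>k\<in>K. c k * character k x) =
      (\<Sum>k\<in>K. indicator torus x *\<^sub>R (c k * character k x))" for x :: "real ^ 'a"
    by (rule scaleR_sum_right)
  have "torus_integral (\<lambda>x. \<Sum>k\<in>K. c k * character k x) = (LBINT x:torus. \<Sum>k\<in>K. c k * character k x)"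
  proof (rule torus_integral_lborel)
    show "set_integrable lborel torus (\<lambda>x. \<Sum>k\<in>K. c k * character k x)"
      using int unfolding set_integrable_def distr by (intro Bochner_Integration.integrable_sum) auto
  qed
  also have "\<dots> = (\<Sum>k\<in>K. LBINT x:torus. c k * character k x)"
    using int unfolding set_lebesgue_integral_def set_integrable_def distr
    by (intro Bochner_Integration.integral_sum) auto
  also have "\<dots> = (\<Sum>k\<in>K. c k * of_bool (k = 0))"
    by (intro sum.cong refl)
      (simp add: torus_integral_lborel[OF set_integrable_character, symmetric] torus_integral_character)
  also have "\<dots> = (if 0 \<in> K then c 0 else 0)"
    using assms by (simp add: if_distrib of_bool_def cong: if_cong)
  finally show ?thesis .
qed

subsection \<open>The curve with velocity \<open>(1, 2n+1, \<dots>)\<close>\<close>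

text \<open>The two linearisations lie \<open>\<bar>s - t\<bar> * infnorm (v - v')\<close> apart
  once this is below \<open>1/2\<close>, yet both approximate \<open>g s\<close> up to
  \<open>o(s - t)\<close>. Uniqueness makes the choice in \<open>torus_velocity\<close>
  canonical.\<close>

lemma has_torus_derivative_unique:
  fixes g :: "real \<Rightarrow> real ^ 'd"
  assumes "has_torus_derivative g v t" "has_torus_derivative g v' t" "t \<in> {0..1}"
  shows "v = v'"
proof -
  define F where "F = at t within {0..1}"
  \<comment> \<open>This covers the endpoints too, where only one-sided limits exist.\<close>
  have nontriv: "F \<noteq> bot"
    unfolding F_def using assms(3) by (simp add: trivial_limit_within islimpt_Icc)
  define r where "r s = torus_dist (g s) (g t + (s - t) *\<^sub>R v) / \<bar>s - t\<bar> +
      torus_dist (g s) (g t + (s - t) *\<^sub>R v') / \<bar>s - t\<bar>" for s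
  have "(r \<longlongrightarrow> 0 + 0) F"
    using assms(1,2) unfolding r_def has_torus_derivative_def F_def by (rule tendsto_add)
  moreover have "eventually (\<lambda>s. infnorm (v - v') \<le> r s) F"
  proof -
    have "((\<lambda>s. \<bar>s - t\<bar> * infnorm (v - v')) \<longlongrightarrow> \<bar>t - t\<bar> * infnorm (v - v')) F"
      unfolding F_def by (intro tendsto_intros)
    then have "eventually (\<lambda>s. \<bar>s - t\<bar> * infnorm (v - v') < 1/2) F"
      by (intro order_tendstoD(2)) auto
    moreover have "eventually (\<lambda>s. s \<noteq> t) F"
      unfolding F_def by (simp add: eventually_at_filter)
    ultimately show ?thesis
    proof eventually_elim
      case (elim s)
      have eq: "infnorm ((g t + (s - t) *\<^sub>R v) - (g t + (s - t) *\<^sub>R v')) = \<bar>s - t\<bar> * infnorm (v - v')"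
        by (simp flip: infnorm_mul add: algebra_simps)
      then have "\<bar>s - t\<bar> * infnorm (v - v') = torus_dist (g t + (s - t) *\<^sub>R v) (g t + (s - t) *\<^sub>R v')"
        using elim(1) by (subst torus_dist_eq_infnorm) auto
      also have "\<dots> \<le> r s * \<bar>s - t\<bar>"
        using torus_dist_triangle[of "g t + (s - t) *\<^sub>R v" "g t + (s - t) *\<^sub>R v'" "g s"] elim(2)
        unfolding r_def distrib_right by simp
      finally show ?case
        using elim(2) by (simp add: mult.commute)
    qed
  qed
  ultimately have "infnorm (v - v') \<le> 0 + 0"
    by (rule tendsto_lowerbound[OF _ _ nontriv])
  then show ?thesis
    using infnorm_pos_lt[of "v - v'"] by auto
qed

lemma torus_velocity_eq:
  "has_torus_derivative g v t \<Longrightarrow> t \<in> {0..1} \<Longrightarrow> torus_velocity g t = v"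
  unfolding torus_velocity_def by (rule some_equality) (auto intro: has_torus_derivative_unique)

lemma has_torus_derivative_velocity:
  "has_torus_derivative g v t \<Longrightarrow> has_torus_derivative g (torus_velocity g t) t"
  unfolding torus_velocity_def by (rule someI)

definition index_rank :: "'d::{finite, linorder} \<Rightarrow> nat" where
  "index_rank i = card {j. j < i}"

lemma index_rank_strict_mono: "strict_mono index_rank"
  unfolding index_rank_def by (intro strict_monoI psubset_card_mono) auto

lemma index_rank_bij: "bij_betw (index_rank :: 'd::{finite, linorder} \<Rightarrow> nat) UNIV {..<CARD('d)}"
proof -
  have "inj (index_rank :: 'd \<Rightarrow> nat)"
    by (rule strict_mono_imp_inj_on[OF index_rank_strict_mono])
  moreover have "range (index_rank :: 'd \<Rightarrow> nat) \<subseteq> {..<CARD('d)}"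
    unfolding index_rank_def by (auto intro!: psubset_card_mono)
  ultimately show ?thesis
    by (simp add: bij_betw_def card_image card_subset_eq)
qed

text \<open>The direction of the straight line whose reduction modulo 1 is
  \<open>gamma_curve\<close>.\<close>

definition gamma_velocity :: "nat \<Rightarrow> real ^ 'd::{finite, linorder}" where
  "gamma_velocity n = (\<chi> i. (2 * real n + 1) ^ index_rank i)"

lemma gamma_curve_diff_Ints:
  "(y *\<^sub>R gamma_velocity n - gamma_curve n y :: real ^ 'd::{finite, linorder}) $ i \<in> \<int>"
  by (simp add: gamma_curve_def gamma_velocity_def frac_def index_rank_def mult.commute)

text \<open>Line and curve agree modulo 1, so the error in the difference quotient is exactly 0,
  even where \<open>frac\<close> jumps.\<close>

lemma torus_velocity_gamma:
  assumes "t \<in> {0..1}"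
  shows "torus_velocity (gamma_curve n) t = (gamma_velocity n :: real ^ 'd::{finite, linorder})"
proof (rule torus_velocity_eq[OF _ assms])
  have "torus_dist (gamma_curve n s) (gamma_curve n t + (s - t) *\<^sub>R gamma_velocity n :: real ^ 'd::{finite, linorder}) = 0" for s
  proof -
    have "torus_dist (gamma_curve n s) (gamma_curve n t + (s - t) *\<^sub>R gamma_velocity n :: real ^ 'd::{finite, linorder}) =
        torus_dist (s *\<^sub>R gamma_velocity n) (s *\<^sub>R gamma_velocity n :: real ^ 'd::{finite, linorder})"
    proof (rule torus_dist_cong)
      fix i :: 'd
      have "- ((s *\<^sub>R gamma_velocity n - gamma_curve n s :: real ^ 'd::{finite, linorder}) $ i) \<in> \<int>"
        using gamma_curve_diff_Ints by (rule Ints_minus)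
      then show "(gamma_curve n s - s *\<^sub>R gamma_velocity n :: real ^ 'd::{finite, linorder}) $ i \<in> \<int>" by simp
      have "- ((t *\<^sub>R gamma_velocity n - gamma_curve n t :: real ^ 'd::{finite, linorder}) $ i) \<in> \<int>"
        using gamma_curve_diff_Ints by (rule Ints_minus)
      then show "(gamma_curve n t + (s - t) *\<^sub>R gamma_velocity n - s *\<^sub>R gamma_velocity n :: real ^ 'd::{finite, linorder}) $ i \<in> \<int>"
        by (simp add: algebra_simps)
    qed
    then show ?thesis by (simp add: torus_dist_eq_infnorm infnorm_0)
  qed
  then show "has_torus_derivative (gamma_curve n) (gamma_velocity n :: real ^ 'd::{finite, linorder}) t"
    by (simp add: has_torus_derivative_def)
qed

lemma curve_length_gamma:
  "curve_length (gamma_curve n :: real \<Rightarrow> real ^ 'd::{finite, linorder})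
     = norm (gamma_velocity n :: real ^ 'd::{finite, linorder})"
proof -
  have "curve_length (gamma_curve n :: real \<Rightarrow> real ^ 'd::{finite, linorder})
      = (LINT t:{0..1 :: real}|lebesgue. norm (gamma_velocity n :: real ^ 'd::{finite, linorder}))"
    unfolding curve_length_def by (intro set_lebesgue_integral_cong) (auto simp: torus_velocity_gamma)
  then show ?thesis by (simp add: set_lebesgue_integral_def)
qed

text \<open>Divisibility in base \<open>M = 2n+1\<close>: beyond the first nonzero digit
  \<open>k $ i0\<close> every term contains a further factor \<open>M\<close>, so a vanishing sum
  would make \<open>M\<close> divide \<open>k $ i0\<close>, whose modulus is at most
  \<open>n\<close>.\<close>

lemma sum_gamma_frequency_nonzero:
  fixes k :: "int ^ 'd::{finite, linorder}"
  assumes "\<And>i. \<bar>k $ i\<bar> \<le> int n" "k \<noteq> 0"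
  shows "(\<Sum>i\<in>UNIV. k $ i * (2 * int n + 1) ^ index_rank i) \<noteq> 0"
proof
  define M where "M = 2 * int n + 1"
  define i0 where "i0 = Min {i. k $ i \<noteq> 0}"
  have ne: "{i. k $ i \<noteq> 0} \<noteq> {}"
    using assms(2) by (auto simp: vec_eq_iff)
  have i0: "k $ i0 \<noteq> 0"
    using Min_in[OF _ ne] by (simp add: i0_def)
  have below: "i0 \<le> i" if "k $ i \<noteq> 0" for i
    unfolding i0_def by (rule Min_le) (use that in auto)
  assume "(\<Sum>i\<in>UNIV. k $ i * (2 * int n + 1) ^ index_rank i) = 0"
  then have "k $ i0 * M ^ index_rank i0 = - (\<Sum>i\<in>UNIV - {i0}. k $ i * M ^ index_rank i)"
    by (simp add: M_def sum.remove[of UNIV i0])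
  also have "M ^ Suc (index_rank i0) dvd \<dots>"
    unfolding dvd_minus_iff
  proof (rule dvd_sum)
    fix i assume "i \<in> UNIV - {i0}"
    show "M ^ Suc (index_rank i0) dvd k $ i * M ^ index_rank i"
    proof (cases "k $ i = 0")
      case False
      then have "i0 < i" using below \<open>i \<in> UNIV - {i0}\<close> by force
      then have "Suc (index_rank i0) \<le> index_rank i"
        using strict_monoD[OF index_rank_strict_mono] by (simp add: Suc_le_eq)
      then show ?thesis by (intro dvd_mult le_imp_power_dvd)
    qed simp
  qed
  finally have "M * M ^ index_rank i0 dvd k $ i0 * M ^ index_rank i0"
    by simp
  then have "M dvd k $ i0"
    by (simp add: M_def)
  then have "\<bar>M\<bar> \<le> \<bar>k $ i0\<bar>"
    using i0 by (rule dvd_imp_le_int[rotated])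
  then show False
    using assms(1)[of i0] by (simp add: M_def)
qed

text \<open>Along the curve a character becomes a one-dimensional exponential whose integer
  frequency \<open>m\<close> vanishes only for \<open>k = 0\<close>.\<close>

lemma integral_character_gamma_curve:
  fixes k :: "int ^ 'd::{finite, linorder}"
  assumes "\<And>i. \<bar>k $ i\<bar> \<le> int n"
  shows "(LINT t:{0..1}|lebesgue. character k (gamma_curve n t)) = of_bool (k = 0)"
proof -
  define m where "m = (\<Sum>i\<in>UNIV. k $ i * (2 * int n + 1) ^ index_rank i)"
  have char: "character k (gamma_curve n t) = cis (2 * pi * of_int m * t)" for t
  proof -
    have "character k (gamma_curve n t) = character k (t *\<^sub>R gamma_velocity n)"
      using gamma_curve_diff_Ints by (intro character_cong[symmetric])
    also have "\<dots> = cis (2 * pi * of_int m * t)"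
      unfolding character_def m_def by (simp add: gamma_velocity_def sum_distrib_left mult_ac)
    finally show ?thesis .
  qed
  have [measurable]: "(\<lambda>t. cis (2 * pi * of_int m * t)) \<in> borel_measurable borel"
    by (intro borel_measurable_continuous_onI continuous_intros)
  have "(LINT t:{0..1}|lebesgue. character k (gamma_curve n t)) = (LBINT t:{0..1}. cis (2 * pi * of_int m * t))"
    unfolding char set_lebesgue_integral_def 
    by (intro integral_completion) measurable
  also have "\<dots> = of_bool (m = 0)"
    by (rule integral_cis_lborel)
  also have "m = 0 \<longleftrightarrow> k = 0"
    using sum_gamma_frequency_nonzero[OF assms] by (auto simp: m_def)
  finally show ?thesis .
qed

lemma norm_gamma_velocity_pos: "norm (gamma_velocity n :: real ^ 'd::{finite, linorder}) > 0"
proof -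
  have "(gamma_velocity n :: real ^ 'd::{finite, linorder}) \<noteq> 0"
    by (auto simp: vec_eq_iff gamma_velocity_def)
  then show ?thesis by simp
qed

text \<open>The speed is the constant \<open>l\<close>, which cancels against the length; what
  remains is the plain parameter integral of each character.\<close>

lemma gamma_curve_exact:
  fixes f :: "real ^ 'd::{finite, linorder} \<Rightarrow> complex"
  assumes "f \<in> trig_polys n"
  shows "1 / of_real (curve_length (gamma_curve n :: real \<Rightarrow> real ^ 'd::{finite, linorder})) * curve_integral (gamma_curve n) f
    = torus_integral f"
proof -
  define K where "K = {k :: int ^ 'd::{finite, linorder}. \<forall>i. \<bar>k $ i\<bar> \<le> int n}"
  have fin: "finite K" unfolding K_def by (rule finite_frequencies)
  obtain c where f: "f = (\<lambda>x. \<Sum>k\<in>K. c k * character k x)"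
    using assms by (auto simp: trig_polys_altdef K_def)
  define l where "l = norm (gamma_velocity n :: real ^ 'd::{finite, linorder})"
  have l: "l > 0" unfolding l_def by (rule norm_gamma_velocity_pos)
  have int: "integrable lebesgue (\<lambda>t. indicator {0..1} t *\<^sub>R character k (gamma_curve n t))" if "k \<in> K" for k
  proof -
    have eq: "character k (gamma_curve n t) = character k (t *\<^sub>R gamma_velocity n)" for t
      by (intro character_cong[symmetric] gamma_curve_diff_Ints)
    have "integrable lborel (\<lambda>t. indicator {0..1} t *\<^sub>R character k (t *\<^sub>R gamma_velocity n))"
      by (intro borel_integrable_compact compact_Icc continuous_intros)
    then have "integrable lebesgue (\<lambda>t. indicator {0..1} t *\<^sub>R character k (t *\<^sub>R gamma_velocity n))"
      by (subst integrable_completion) (auto dest: borel_measurable_integrable)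
    then show ?thesis by (simp only: eq)
  qed
  have "curve_integral (gamma_curve n) f = (LINT t:{0..1}|lebesgue. f (gamma_curve n t) * of_real l)"
    unfolding curve_integral_def l_def
    by (intro set_lebesgue_integral_cong) (auto simp: torus_velocity_gamma)
  also have "\<dots> = (LINT t|lebesgue. of_real l * (\<Sum>k\<in>K. c k * (indicator {0..1} t *\<^sub>R character k (gamma_curve n t))))"
    unfolding set_lebesgue_integral_def f
    by (rule Bochner_Integration.integral_cong) (simp_all add: indicator_def mult.commute)
  also have "\<dots> = of_real l * (LINT t|lebesgue. (\<Sum>k\<in>K. c k * (indicator {0..1} t *\<^sub>R character k (gamma_curve n t))))"
    by (rule integral_mult_right_zero)
  also have "\<dots> = of_real l * (\<Sum>k\<in>K. c k * (LINT t:{0..1}|lebesgue. character k (gamma_curve n t)))"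
    using int unfolding set_lebesgue_integral_def
    by (subst Bochner_Integration.integral_sum) (simp_all only: integrable_mult_right integral_mult_right_zero)
  also have "\<dots> = of_real l * (\<Sum>k\<in>K. c k * of_bool (k = 0))"
    by (intro arg_cong[where f = "\<lambda>x. of_real l * x"] sum.cong refl)
      (subst integral_character_gamma_curve, auto simp: K_def)
  also have "\<dots> = of_real l * torus_integral f"
    unfolding f torus_integral_sum_character[OF fin]
    using fin by (simp add: if_distrib of_bool_def cong: if_cong)
  finally show ?thesis
    using l by (simp add: curve_length_gamma flip: l_def)
qed

text \<open>The squared norm is a geometric series with ratio \<open>M\<^sup>2 \<ge> 9\<close>,
  hence at most \<open>M\<^sup>2 / (M\<^sup>2 - 1) \<le> 9/8\<close> times its last term;
  \<open>9/8\<close> is the square of \<open>3 / sqrt 8\<close>.\<close>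

lemma norm_gamma_velocity_le:
  assumes "n \<ge> 1"
  shows "norm (gamma_velocity n :: real ^ 'd::{finite, linorder}) \<le> 3 / sqrt 8 * (2 * real n + 1) ^ (CARD('d) - 1)"
proof -
  define M where "M = 2 * real n + 1"
  have M: "M \<ge> 3" using assms by (simp add: M_def)
  then have M2: "M\<^sup>2 \<ge> 9" using power_mono[of 3 M 2] by simp
  have d: "(M\<^sup>2) ^ CARD('d) = M\<^sup>2 * (M\<^sup>2) ^ (CARD('d) - 1)"
    using power_minus_mult[of "CARD('d)" "M\<^sup>2"] by (simp add: mult.commute)
  have sq: "(M ^ (CARD('d) - 1))\<^sup>2 = (M\<^sup>2) ^ (CARD('d) - 1)"
    by (metis power_mult mult.commute)
  have "(norm (gamma_velocity n :: real ^ 'd::{finite, linorder}))\<^sup>2 = (\<Sum>i\<in>(UNIV :: 'd set). (M\<^sup>2) ^ index_rank i)"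
    unfolding power2_norm_eq_inner inner_vec_def gamma_velocity_def
    by (simp add: M_def power2_eq_square power_mult_distrib)
  also have "\<dots> = (\<Sum>p<CARD('d). (M\<^sup>2) ^ p)"
    by (rule sum.reindex_bij_betw[OF index_rank_bij])
  also have "\<dots> = ((M\<^sup>2) ^ CARD('d) - 1) / (M\<^sup>2 - 1)"
    using M2 by (subst geometric_sum) auto
  also have "\<dots> \<le> (M\<^sup>2) ^ CARD('d) / (M\<^sup>2 - 1)"
    using M2 by (intro divide_right_mono) auto
  also have "\<dots> = M\<^sup>2 / (M\<^sup>2 - 1) * (M\<^sup>2) ^ (CARD('d) - 1)"
    by (simp add: d)
  also have "\<dots> \<le> 9/8 * (M\<^sup>2) ^ (CARD('d) - 1)"
    using M2 by (intro mult_right_mono) (auto simp: field_simps)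
  also have "\<dots> = (3 / sqrt 8 * M ^ (CARD('d) - 1))\<^sup>2"
    unfolding power_mult_distrib power_divide sq by simp
  finally show ?thesis
    unfolding M_def by (rule power2_le_imp_le) simp
qed

text \<open>The point \<open>x\<close> below lies halfway between two consecutive strands of the curve, projected to
  the first two coordinates.\<close>

lemma covering_radius_gamma_ge:
  assumes "CARD('d::{finite, linorder}) \<ge> 2"
  shows "covering_radius (gamma_curve n ` {0..1} :: (real ^ 'd::{finite, linorder}) set) \<ge> 1/4 * (1 / (real n + 1))"
proof -
  define M where "M = 2 * real n + 1"
  have M: "M \<ge> 1" by (simp add: M_def)
  \<comment> \<open>The coordinates of rank 0 and 1, with velocities \<open>1\<close> and
    \<open>M\<close>, suffice for the obstruction.\<close>
  have "0 \<in> index_rank ` (UNIV :: 'd set)" "1 \<in> index_rank ` (UNIV :: 'd set)"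
    using assms bij_betw_imp_surj_on[OF index_rank_bij[where 'd = 'd]] by auto
  then obtain i0 i1 :: 'd where i: "index_rank i0 = 0" "index_rank i1 = 1"
    by (metis imageE)
  then have "i1 \<noteq> i0" by auto
  define x :: "real ^ 'd::{finite, linorder}" where "x = (\<chi> i. if i = i0 then 1 / (2 * M) else 0)"
  show ?thesis
  proof (rule covering_radius_ge)
    show "x \<in> torus" using M by (auto simp: x_def torus_def)
  next
    fix y :: "real ^ 'd::{finite, linorder}" assume "y \<in> gamma_curve n ` {0..1}"
    then obtain t where y: "y = gamma_curve n t" by blast
    have "torus_dist y x = torus_dist (t *\<^sub>R gamma_velocity n) x"
    proof (rule torus_dist_cong)
      fix i :: 'd
      have "- ((t *\<^sub>R gamma_velocity n - gamma_curve n t :: real ^ 'd::{finite, linorder}) $ i) \<in> \<int>"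
        using gamma_curve_diff_Ints by (rule Ints_minus)
      then show "(y - t *\<^sub>R gamma_velocity n) $ i \<in> \<int>" by (simp add: y)
    qed simp
    also have "\<dots> \<ge> 1/4 * (1 / (real n + 1))"
    proof (rule torus_dist_ge)
      fix z :: "real ^ 'd::{finite, linorder}" assume z: "\<And>i. z $ i \<in> \<int>"
      define r where "r = infnorm (t *\<^sub>R gamma_velocity n - x + z)"
      have r0: "\<bar>t - 1 / (2 * M) + z $ i0\<bar> \<le> r"
        using component_le_infnorm_cart[of "t *\<^sub>R gamma_velocity n - x + z" i0] i
        by (simp add: r_def x_def gamma_velocity_def)
      have r1: "\<bar>t * M + z $ i1\<bar> \<le> r"
        using component_le_infnorm_cart[of "t *\<^sub>R gamma_velocity n - x + z" i1] i \<open>i1 \<noteq> i0\<close>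
        by (simp add: r_def x_def gamma_velocity_def M_def)
      have "z $ i1 - M * z $ i0 \<in> \<int>"
        using z by (auto simp: M_def intro!: Ints_diff Ints_mult Ints_add)
      then obtain j where j: "z $ i1 - M * z $ i0 = of_int j" by (elim Ints_cases)
      \<comment> \<open>Eliminating \<open>t\<close>: the second offset minus \<open>M\<close> times
        the first is a half-integer. Since \<open>1 + M = 2 * (n + 1)\<close>, the larger offset is
        at least \<open>1 / (4 * (n + 1))\<close>.\<close>
      have "1/2 \<le> \<bar>1/2 + of_int j :: real\<bar>"
      proof (cases "j \<ge> 0")
        case False
        then have "real_of_int j \<le> real_of_int (- 1)" by (subst of_int_le_iff) simp
        then show ?thesis by simp
      qed simp
      also have "1/2 + of_int j = (t * M + z $ i1) - M * (t - 1 / (2 * M) + z $ i0)"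
        using M j by (simp add: field_simps)
      also have "\<bar>\<dots>\<bar> \<le> r + M * r"
      proof -
        have "\<bar>M * (t - 1 / (2 * M) + z $ i0)\<bar> \<le> M * r"
          unfolding abs_mult using M r0 by (intro mult_mono) auto
        then show ?thesis using r1 by linarith
      qed
      finally have "1/2 \<le> 2 * (real n + 1) * r"
        by (simp add: M_def algebra_simps)
      then show "1/4 * (1 / (real n + 1)) \<le> infnorm (t *\<^sub>R gamma_velocity n - x + z)"
        by (simp add: r_def field_simps)
    qed
    finally show "1/4 * (1 / (real n + 1)) \<le> torus_dist y x" .
  qed auto
qed

subsection \<open>Means of trigonometric polynomials\<close>

text \<open>Exactness is always applied in this form: a test function enters only through membership
  in the space and its mean.\<close>

definition trig_mean :: "nat \<Rightarrow> (real ^ 'd \<Rightarrow> complex) \<Rightarrow> complex \<Rightarrow> bool" where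
  "trig_mean n f \<mu> \<longleftrightarrow> f \<in> trig_polys n \<and> torus_integral f = \<mu>"

text \<open>By orthogonality the mean is the coefficient at 0, so means of composite polynomials can
  be computed algebraically.\<close>

lemma trig_mean_altdef:
  "trig_mean n f \<mu> \<longleftrightarrow>
     (\<exists>c. f = (\<lambda>x. \<Sum>k | \<forall>i. \<bar>k $ i\<bar> \<le> int n. c k * character k x) \<and> c 0 = \<mu>)"
  unfolding trig_mean_def trig_polys_altdef
  by (auto simp: torus_integral_sum_character finite_frequencies)

lemma trig_mean_character:
  assumes "\<And>i. \<bar>k $ i\<bar> \<le> int n"
  shows "trig_mean n (character k) (of_bool (k = 0))"
  unfolding trig_mean_altdef
proof (intro exI conjI ext)
  fix x
  have "(\<Sum>k' | \<forall>i. \<bar>k' $ i\<bar> \<le> int n. of_bool (k = k') * character k' x) =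
      (\<Sum>k' | \<forall>i. \<bar>k' $ i\<bar> \<le> int n. if k = k' then character k' x else 0)"
    by (intro sum.cong) auto
  also have "\<dots> = character k x"
    using assms by (simp add: finite_frequencies)
  finally show "character k x = (\<Sum>k' | \<forall>i. \<bar>k' $ i\<bar> \<le> int n. of_bool (k = k') * character k' x)" ..
qed simp

lemma trig_mean_cmult:
  assumes "trig_mean n f \<mu>"
  shows "trig_mean n (\<lambda>x. a * f x) (a * \<mu>)"
proof -
  obtain c where c: "f = (\<lambda>x. \<Sum>k | \<forall>i. \<bar>k $ i\<bar> \<le> int n. c k * character k x)" "c 0 = \<mu>"
    using assms unfolding trig_mean_altdef by blast
  show ?thesis
    unfolding trig_mean_altdef
    by (rule exI[of _ "\<lambda>k. a * c k"]) (simp add: c sum_distrib_left mult.assoc)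
qed

lemma trig_mean_sum:
  assumes "\<And>s. s \<in> S \<Longrightarrow> trig_mean n (f s) (\<mu> s)"
  shows "trig_mean n (\<lambda>x. \<Sum>s\<in>S. f s x) (\<Sum>s\<in>S. \<mu> s)"
proof -
  have "\<forall>s\<in>S. \<exists>c. f s = (\<lambda>x. \<Sum>k | \<forall>i. \<bar>k $ i\<bar> \<le> int n. c k * character k x) \<and> c 0 = \<mu> s"
    using assms unfolding trig_mean_altdef by blast
  from bchoice[OF this] obtain c where c: "\<And>s. s \<in> S \<Longrightarrow> f s = (\<lambda>x. \<Sum>k | \<forall>i. \<bar>k $ i\<bar> \<le> int n. c s k * character k x)"
    "\<And>s. s \<in> S \<Longrightarrow> c s 0 = \<mu> s"
    by blast
  show ?thesis
    unfolding trig_mean_altdef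
  proof (intro exI[of _ "\<lambda>k. \<Sum>s\<in>S. c s k"] conjI ext)
    fix x
    have "(\<Sum>s\<in>S. f s x) = (\<Sum>s\<in>S. \<Sum>k | \<forall>i. \<bar>k $ i\<bar> \<le> int n. c s k * character k x)"
      by (intro sum.cong) (simp_all add: c)
    also have "\<dots> = (\<Sum>k | \<forall>i. \<bar>k $ i\<bar> \<le> int n. (\<Sum>s\<in>S. c s k) * character k x)"
      by (subst sum.swap) (simp add: sum_distrib_right)
    finally show "(\<Sum>s\<in>S. f s x) = \<dots>" .
  qed (simp add: c)
qed

lemma trig_mean_diff:
  assumes "trig_mean n f \<mu>" "trig_mean n g \<nu>"
  shows "trig_mean n (\<lambda>x. f x - g x) (\<mu> - \<nu>)"
proof -
  \<comment> \<open>A difference is a two-term sum indexed by the Booleans, one summand carrying the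
    factor \<open>-1\<close>.\<close>
  have "trig_mean n (\<lambda>x. \<Sum>b\<in>UNIV. (if b then f else (\<lambda>x. - 1 * g x)) x) (\<Sum>b\<in>UNIV. if b then \<mu> else - 1 * \<nu>)"
  proof (rule trig_mean_sum)
    fix b
    show "trig_mean n (if b then f else (\<lambda>x. - 1 * g x)) (if b then \<mu> else - 1 * \<nu>)"
      by (cases b) (simp_all only: if_True if_False assms trig_mean_cmult)
  qed
  then show ?thesis by (simp add: UNIV_bool)
qed

text \<open>Translation multiplies the coefficient at \<open>k\<close> by
  \<open>character k (- y)\<close>, which is 1 at \<open>k = 0\<close>.\<close>

lemma trig_mean_shift:
  assumes "trig_mean n f \<mu>"
  shows "trig_mean n (\<lambda>x. f (x - y)) \<mu>"
proof -
  obtain c where c: "f = (\<lambda>x. \<Sum>k | \<forall>i. \<bar>k $ i\<bar> \<le> int n. c k * character k x)" "c 0 = \<mu>"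
    using assms unfolding trig_mean_altdef by blast
  show ?thesis
    unfolding trig_mean_altdef
  proof (intro exI[of _ "\<lambda>k. c k * character k (- y)"] conjI ext)
    fix x
    show "f (x - y) = (\<Sum>k | \<forall>i. \<bar>k $ i\<bar> \<le> int n. c k * character k (- y) * character k x)"
      using character_add[of _ x "- y"] by (simp add: c mult_ac)
  qed (simp add: c)
qed

text \<open>Expanding the product selects one term \<open>\<phi> i\<close> per coordinate. The mean
  factors again because the frequency vector \<open>k \<phi>\<close> vanishes exactly when all its
  coordinates do. The labels \<open>s\<close> permit several terms of equal frequency.\<close>

lemma trig_mean_prod:
  fixes c :: "'d::finite \<Rightarrow> 's \<Rightarrow> complex" and \<kappa> :: "'s \<Rightarrow> int"
  assumes fin: "\<And>i. finite (S i)" and deg: "\<And>i s. s \<in> S i \<Longrightarrow> \<bar>\<kappa> s\<bar> \<le> int n"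
  shows "trig_mean n (\<lambda>x. \<Prod>i\<in>UNIV. \<Sum>s\<in>S i. c i s * cis (2 * pi * of_int (\<kappa> s) * x $ i))
           (\<Prod>i\<in>UNIV. \<Sum>s\<in>S i. c i s * of_bool (\<kappa> s = 0))"
proof -
  define k where "k \<phi> = (\<chi> i. \<kappa> (\<phi> i))" for \<phi> :: "'d \<Rightarrow> 's"
  have "trig_mean n (\<lambda>x. \<Sum>\<phi>\<in>PiE UNIV S. (\<Prod>i\<in>UNIV. c i (\<phi> i)) * character (k \<phi>) x)
          (\<Sum>\<phi>\<in>PiE UNIV S. (\<Prod>i\<in>UNIV. c i (\<phi> i)) * of_bool (k \<phi> = 0))"
    using deg by (intro trig_mean_sum trig_mean_cmult trig_mean_character) (auto simp: k_def PiE_iff)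
  also have "(\<lambda>x. \<Sum>\<phi>\<in>PiE UNIV S. (\<Prod>i\<in>UNIV. c i (\<phi> i)) * character (k \<phi>) x) =
      (\<lambda>x. \<Prod>i\<in>UNIV. \<Sum>s\<in>S i. c i s * cis (2 * pi * of_int (\<kappa> s) * x $ i))"
    using fin by (intro ext) (simp add: prod_sum_PiE character_prod k_def prod.distrib)
  also have "(\<Sum>\<phi>\<in>PiE UNIV S. (\<Prod>i\<in>UNIV. c i (\<phi> i)) * of_bool (k \<phi> = 0)) =
      (\<Sum>\<phi>\<in>PiE UNIV S. \<Prod>i\<in>UNIV. c i (\<phi> i) * of_bool (\<kappa> (\<phi> i) = 0))"
  proof (rule sum.cong[OF refl])
    fix \<phi>
    have "(of_bool (k \<phi> = 0) :: complex) = (\<Prod>i\<in>UNIV. of_bool (\<kappa> (\<phi> i) = 0))"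
    proof (cases "k \<phi> = 0")
      case True
      then show ?thesis by (simp add: k_def vec_eq_iff)
    next
      case False
      then obtain i where "\<kappa> (\<phi> i) \<noteq> 0" by (auto simp: k_def vec_eq_iff)
      with False show ?thesis by (auto simp: prod_zero_iff)
    qed
    then show "(\<Prod>i\<in>UNIV. c i (\<phi> i)) * of_bool (k \<phi> = 0) =
        (\<Prod>i\<in>UNIV. c i (\<phi> i) * of_bool (\<kappa> (\<phi> i) = 0))"
      by (simp add: prod.distrib)
  qed
  also have "\<dots> = (\<Prod>i\<in>UNIV. \<Sum>s\<in>S i. c i s * of_bool (\<kappa> s = 0))"
    by (rule prod_sum_PiE[symmetric]) (use fin in auto)
  finally show ?thesis .
qed

section \<open>Fejer kernels with general weights\<close>

text \<open>As a squared modulus it is nonnegative, and its degree is at most \<open>m - 1\<close>.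
  Constant weights give the normalised Fejer kernel used for curves, sine weights the kernel used
  for point quadrature.\<close>

definition fejer :: "(nat \<Rightarrow> real) \<Rightarrow> nat \<Rightarrow> real \<Rightarrow> real" where
  "fejer a m t = (norm (\<Sum>j<m. of_real (a j) * cis (2 * pi * real j * t)))\<^sup>2"

lemma fejer_nonneg: "fejer a m t \<ge> 0"
  by (simp add: fejer_def)

lemma fejer_expand:
  "complex_of_real (fejer a m t) =
     (\<Sum>j<m. \<Sum>l<m. of_real (a j * a l) * cis (2 * pi * of_int (int j - int l) * t))"
proof -
  have "complex_of_real (fejer a m t) = (\<Sum>j<m. of_real (a j) * cis (2 * pi * real j * t)) *
      cnj (\<Sum>l<m. of_real (a l) * cis (2 * pi * real l * t))"
    unfolding fejer_def complex_norm_square[symmetric] by simp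
  also have "\<dots> = (\<Sum>j<m. \<Sum>l<m. of_real (a j * a l) * cis (2 * pi * of_int (int j - int l) * t))"
    unfolding sum_product cnj_sum complex_cnj_mult cis_cnj complex_cnj_complex_of_real
  proof (intro sum.cong refl)
    fix j l
    have "cis (2 * pi * of_int (int j - int l) * t) = cis (2 * pi * real j * t) * cis (- (2 * pi * real l * t))"
      unfolding cis_mult by (simp add: algebra_simps)
    then show "complex_of_real (a j) * cis (2 * pi * real j * t) * (complex_of_real (a l) * cis (- (2 * pi * real l * t))) =
        complex_of_real (a j * a l) * cis (2 * pi * of_int (int j - int l) * t)"
      by (simp only: of_real_mult mult_ac)
  qed
  finally show ?thesis .
qed

text \<open>Term \<open>(j, l, e)\<close> has frequency \<open>j - l + e\<close>. The set
  \<open>E i\<close> holds the frequencies of an extra factor in coordinate \<open>i\<close>: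
  \<open>{0}\<close> for none, \<open>{-1, 1}\<close> with weight \<open>1/2\<close> for a
  cosine.\<close>

lemma trig_mean_fejer_weighted:
  fixes E :: "'d::finite \<Rightarrow> int set" and b :: "'d \<Rightarrow> complex"
  assumes fin: "\<And>i. finite (E i)" and deg: "\<And>i e. e \<in> E i \<Longrightarrow> int m - 1 + \<bar>e\<bar> \<le> int n"
  shows "trig_mean n (\<lambda>x. \<Prod>i\<in>UNIV. of_real (fejer a m (x $ i)) * (\<Sum>e\<in>E i. b i * cis (2 * pi * of_int e * x $ i)))
           (\<Prod>i\<in>UNIV. \<Sum>j<m. \<Sum>l<m. \<Sum>e\<in>E i. of_real (a j * a l) * b i * of_bool (int j - int l + e = 0))"
proof -
  define S where "S i = {..<m} \<times> {..<m} \<times> E i" for i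
  define \<kappa> where "\<kappa> = (\<lambda>(j, l, e). int j - int l + e)"
  define c where "c i = (\<lambda>(j, l, e :: int). complex_of_real (a j * a l) * b i)" for i
  have S: "(\<Sum>s\<in>S i. f s) = (\<Sum>j<m. \<Sum>l<m. \<Sum>e\<in>E i. f (j, l, e))" for f :: "_ \<Rightarrow> complex" and i
    using fin by (simp add: S_def sum.cartesian_product')
  have "trig_mean n (\<lambda>x. \<Prod>i\<in>UNIV. \<Sum>s\<in>S i. c i s * cis (2 * pi * of_int (\<kappa> s) * x $ i))
           (\<Prod>i\<in>UNIV. \<Sum>s\<in>S i. c i s * of_bool (\<kappa> s = 0))"
  proof (rule trig_mean_prod)
    fix i s assume "s \<in> S i"
    then show "\<bar>\<kappa> s\<bar> \<le> int n"
      using deg[of _ i] by (force simp: S_def \<kappa>_def)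
  qed (use fin in \<open>simp add: S_def\<close>)
  also have "(\<lambda>x. \<Prod>i\<in>UNIV. \<Sum>s\<in>S i. c i s * cis (2 * pi * of_int (\<kappa> s) * x $ i)) =
      (\<lambda>x. \<Prod>i\<in>UNIV. of_real (fejer a m (x $ i)) * (\<Sum>e\<in>E i. b i * cis (2 * pi * of_int e * x $ i)))"
    unfolding S fejer_expand sum_distrib_right unfolding sum_distrib_left
  proof (intro ext prod.cong sum.cong refl)
    fix x :: "real ^ 'd" and i j l e
    have "cis (2 * pi * of_int (int j - int l + e) * x $ i) =
        cis (2 * pi * of_int (int j - int l) * x $ i) * cis (2 * pi * of_int e * x $ i)"
      unfolding cis_mult by (simp add: algebra_simps)
    then show "c i (j, l, e) * cis (2 * pi * of_int (\<kappa> (j, l, e)) * x $ i) =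
        complex_of_real (a j * a l) * cis (2 * pi * of_int (int j - int l) * x $ i) *
          (b i * cis (2 * pi * of_int e * x $ i))"
      by (simp only: c_def \<kappa>_def prod.case mult_ac)
  qed
  also have "(\<Prod>i\<in>UNIV. \<Sum>s\<in>S i. c i s * of_bool (\<kappa> s = 0)) =
      (\<Prod>i\<in>UNIV. \<Sum>j<m. \<Sum>l<m. \<Sum>e\<in>E i. of_real (a j * a l) * b i * of_bool (int j - int l + e = 0))"
    unfolding S by (simp add: c_def \<kappa>_def)
  finally show ?thesis .
qed

text \<open>Only the diagonal \<open>j = l\<close> has frequency 0, and every coordinate contributes
  the same factor.\<close>

lemma trig_mean_fejer:
  assumes "int m - 1 \<le> int n"
  shows "trig_mean n (\<lambda>x :: real ^ 'd. of_real (\<Prod>i\<in>UNIV. fejer a m (x $ i)))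
           (of_real ((\<Sum>j<m. (a j)\<^sup>2) ^ CARD('d)))"
proof -
  have "trig_mean n (\<lambda>x :: real ^ 'd. \<Prod>i\<in>UNIV. of_real (fejer a m (x $ i)) *
        (\<Sum>e\<in>{0 :: int}. 1 * cis (2 * pi * of_int e * x $ i)))
      (\<Prod>i\<in>(UNIV :: 'd set). \<Sum>j<m. \<Sum>l<m. \<Sum>e\<in>{0 :: int}. of_real (a j * a l) * 1 * of_bool (int j - int l + e = 0))"
    by (rule trig_mean_fejer_weighted[where E = "\<lambda>_. {0}" and b = "\<lambda>_. 1"]) (use assms in auto)
  moreover have "(\<Sum>l<m. complex_of_real (a j * a l) * of_bool (int j - int l = 0)) = of_real ((a j)\<^sup>2)"
    if "j < m" for j
  proof -
    have "(\<Sum>l<m. complex_of_real (a j * a l) * of_bool (int j - int l = 0)) =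
        (\<Sum>l<m. if j = l then complex_of_real (a j * a l) else 0)"
      by (intro sum.cong) auto
    then show ?thesis using that by (simp add: power2_eq_square)
  qed
  ultimately show ?thesis by simp
qed

text \<open>In coordinate \<open>i0\<close> the cosine couples neighbouring weights; the factor is
  the quadratic form of half the path adjacency matrix, which \<open>eigen\<close> evaluates to
  \<open>q\<close> times the sum of squares. The cosine costs one degree, hence
  \<open>m \<le> n\<close>.\<close>

lemma trig_mean_cos_fejer:
  fixes i0 :: "'d::finite"
  assumes "int m \<le> int n"
    and eigen: "\<And>j. j < m \<Longrightarrow> (if Suc j < m then a (Suc j) else 0) + (if j > 0 then a (j - 1) else 0) = 2 * q * a j"
  shows "trig_mean n (\<lambda>x :: real ^ 'd. of_real (cos (2 * pi * x $ i0) * (\<Prod>i\<in>UNIV. fejer a m (x $ i))))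
           (of_real (q * (\<Sum>j<m. (a j)\<^sup>2) ^ CARD('d)))"
proof -
  define E where "E i = (if i = i0 then {-1, 1} else {0 :: int})" for i
  define b where "b i = (if i = i0 then 1/2 else 1 :: complex)" for i
  define A where "A = (\<Sum>j<m. (a j)\<^sup>2)"
  have "trig_mean n (\<lambda>x :: real ^ 'd. \<Prod>i\<in>UNIV. of_real (fejer a m (x $ i)) *
        (\<Sum>e\<in>E i. b i * cis (2 * pi * of_int e * x $ i)))
      (\<Prod>i\<in>UNIV. \<Sum>j<m. \<Sum>l<m. \<Sum>e\<in>E i. of_real (a j * a l) * b i * of_bool (int j - int l + e = 0))"
    by (rule trig_mean_fejer_weighted) (use assms(1) in \<open>auto simp: E_def split: if_splits\<close>)
  also have "(\<lambda>x :: real ^ 'd. \<Prod>i\<in>UNIV. of_real (fejer a m (x $ i)) *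
        (\<Sum>e\<in>E i. b i * cis (2 * pi * of_int e * x $ i))) =
      (\<lambda>x. of_real (cos (2 * pi * x $ i0) * (\<Prod>i\<in>UNIV. fejer a m (x $ i))))"
  proof
    fix x :: "real ^ 'd"
    have "(\<Sum>e\<in>E i. b i * cis (2 * pi * of_int e * x $ i)) = (if i = i0 then of_real (cos (2 * pi * x $ i0)) else 1)" for i
      by (auto simp: E_def b_def complex_eq_iff)
    then show "(\<Prod>i\<in>UNIV. of_real (fejer a m (x $ i)) * (\<Sum>e\<in>E i. b i * cis (2 * pi * of_int e * x $ i))) =
        complex_of_real (cos (2 * pi * x $ i0) * (\<Prod>i\<in>UNIV. fejer a m (x $ i)))"
      by (simp add: prod.distrib mult.commute)
  qed
  also have "(\<Prod>i\<in>UNIV. \<Sum>j<m. \<Sum>l<m. \<Sum>e\<in>E i. of_real (a j * a l) * b i * of_bool (int j - int l + e = 0)) =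
      (\<Prod>i\<in>(UNIV :: 'd set). if i = i0 then of_real (q * A) else of_real A)"
  proof (rule prod.cong[OF refl])
    fix i :: 'd
    show "(\<Sum>j<m. \<Sum>l<m. \<Sum>e\<in>E i. complex_of_real (a j * a l) * b i * of_bool (int j - int l + e = 0)) =
        (if i = i0 then of_real (q * A) else of_real A)"
    proof (cases "i = i0")
      case False
      then show ?thesis
        by (simp add: E_def b_def A_def of_bool_def if_distrib power2_eq_square cong: if_cong)
    next
      case True
      have "(\<Sum>l<m. \<Sum>e\<in>E i. complex_of_real (a j * a l) * b i * of_bool (int j - int l + e = 0)) =
          of_real (q * (a j)\<^sup>2)" if j: "j < m" for j
      proof -
        \<comment> \<open>\<open>e = 1\<close> forces \<open>l = j + 1\<close> and
          \<open>e = -1\<close> forces \<open>l = j - 1\<close>; the guard \<open>j > 0\<close>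
          rules out the truncated value \<open>0 - 1 = 0\<close>.\<close>
        have "(\<Sum>l<m. \<Sum>e\<in>E i. complex_of_real (a j * a l) * b i * of_bool (int j - int l + e = 0)) =
            of_real (a j / 2) * ((\<Sum>l<m. of_real (a l) * of_bool (l = Suc j)) + (\<Sum>l<m. of_real (a l) * of_bool (j > 0 \<and> l = j - 1)))"
          unfolding sum.distrib[symmetric] sum_distrib_left
          by (intro sum.cong refl) (auto simp: E_def b_def True of_bool_def)
        also have "\<dots> = of_real (a j / 2 * ((if Suc j < m then a (Suc j) else 0) + (if j > 0 then a (j - 1) else 0)))"
          using j by (auto simp: of_bool_def if_distrib cong: if_cong)
        also have "\<dots> = of_real (q * (a j)\<^sup>2)"
          unfolding eigen[OF j] by (simp add: power2_eq_square)
        finally show ?thesis .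
      qed
      then show ?thesis using True by (simp add: A_def sum_distrib_left)
    qed
  qed
  also have "\<dots> = of_real (q * A ^ CARD('d))"
  proof -
    have "(\<Prod>i\<in>(UNIV :: 'd set). if i = i0 then of_real (q * A) else of_real A) =
        (\<Prod>i\<in>(UNIV :: 'd set). complex_of_real (if i = i0 then q else 1) * of_real A)"
      by (intro prod.cong) auto
    also have "\<dots> = of_real ((\<Prod>i\<in>(UNIV :: 'd set). if i = i0 then q else 1) * A ^ CARD('d))"
      unfolding prod.distrib of_real_mult of_real_prod by simp
    finally show ?thesis by simp
  qed
  finally show ?thesis by (simp add: A_def)
qed

subsection \<open>Covering radius of quadrature points\<close>

text \<open>The sine sequence is the eigenvector of the path graph on \<open>n\<close> vertices for its largest
  eigenvalue; this choice of coefficients makes the first Fourier coefficient of the kernel maximal.\<close>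

lemma sine_eigenvector:
  fixes \<theta> :: real
  assumes "\<theta> = pi / (real n + 1)" "j < n"
  defines "a \<equiv> \<lambda>j. sin (\<theta> * (real j + 1))"
  shows "(if Suc j < n then a (Suc j) else 0) + (if j > 0 then a (j - 1) else 0) = 2 * cos \<theta> * a j"
proof -
  \<comment> \<open>The missing neighbours beyond the ends are replaced by \<open>sin pi = 0\<close>
    and \<open>sin 0 = 0\<close>, so the addition formula also holds there.\<close>
  have "(if Suc j < n then a (Suc j) else 0) = sin (\<theta> * (real j + 1) + \<theta>)"
  proof (cases "Suc j < n")
    case False
    then have "n = Suc j" using assms(2) by simp
    then have "\<theta> * (real j + 1) + \<theta> = \<theta> * (real n + 1)" by (simp add: algebra_simps)
    also have "\<dots> = pi" by (simp add: assms(1))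
    finally have "\<theta> * (real j + 1) + \<theta> = pi" .
    with False show ?thesis by simp
  qed (simp add: a_def algebra_simps)
  moreover have "(if j > 0 then a (j - 1) else 0) = sin (\<theta> * (real j + 1) - \<theta>)"
    by (cases "j > 0") (simp_all add: a_def of_nat_diff algebra_simps)
  ultimately show ?thesis
    by (simp add: sin_add sin_diff a_def)
qed

text \<open>\<open>1 - cos (2 * x) = 2 * (1 - cos x) * (1 + cos x)\<close> is at least
  \<open>2 * (1 - cos x)\<close> as long as \<open>cos x \<ge> 0\<close>, and every angle before the
  last doubling is at most \<open>pi / 2\<close>.\<close>

lemma one_minus_cos_double_le:
  fixes \<phi> :: real
  assumes "0 \<le> \<phi>" "2 ^ k * \<phi> \<le> pi"
  shows "2 ^ k * (1 - cos \<phi>) \<le> 1 - cos (2 ^ k * \<phi>)"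
  using assms(2)
proof (induction k)
  case (Suc k)
  have half: "2 ^ k * \<phi> \<le> pi / 2" "0 \<le> 2 ^ k * \<phi>" using Suc.prems assms(1) by auto
  then have c: "0 \<le> cos (2 ^ k * \<phi>)" by (intro cos_ge_zero) auto
  have "2 ^ Suc k * (1 - cos \<phi>) \<le> 2 * (1 - cos (2 ^ k * \<phi>))"
    using Suc.IH half pi_ge_zero by simp
  also have "\<dots> \<le> 2 * (1 - cos (2 ^ k * \<phi>)) * (1 + cos (2 ^ k * \<phi>))"
    using c mult_left_mono[of 1 "1 + cos (2 ^ k * \<phi>)" "2 * (1 - cos (2 ^ k * \<phi>))"] by simp
  also have "\<dots> = 1 - cos (2 * (2 ^ k * \<phi>))"
    unfolding cos_double_cos by (simp add: power2_eq_square algebra_simps)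
  finally show ?case by (simp add: mult_ac)
qed simp

text \<open>If the cube of radius \<open>r\<close> around \<open>y\<close> contained no point, every
  summand of the rule for the shifted test polynomial would be nonpositive, although exactness makes
  their sum positive.\<close>

lemma quadrature_covering_radius:
  fixes x :: "nat \<Rightarrow> real ^ 'd"
  assumes n: "n \<ge> 1" and w: "\<And>j. j < N \<Longrightarrow> w j > 0" and exact: "quadrature_exact n N x w"
  shows "covering_radius (x ` {..<N}) \<le> 2 ^ (CARD('d) - 1) * (1 / (real n + 1))"
proof -
  define d where "d = CARD('d)"
  define r where "r = 2 ^ (d - 1) * (1 / (real n + 1))"
  have mean: "(\<Sum>j<N. of_real (w j) * f (x j)) = \<mu>" if "trig_mean n f \<mu>" for f \<mu>
    using exact that by (auto simp: quadrature_exact_def trig_mean_def)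
  \<comment> \<open>The empty sum would have to equal the mean 1 of the constant polynomial.\<close>
  have "N \<noteq> 0"
    using mean[OF trig_mean_character[of 0 n]] by (intro notI) simp
  have "covering_radius (x ` {..<N}) \<le> r"
  proof (rule covering_radius_le)
    show "x ` {..<N} \<noteq> {}" using \<open>N \<noteq> 0\<close> by auto
    fix y :: "real ^ 'd" assume "y \<in> torus"
    show "\<exists>z\<in>x ` {..<N}. torus_dist z y \<le> r"
    \<comment> \<open>The case \<open>r > 1/2\<close> is trivial; otherwise
      \<open>2 * pi * r \<le> pi\<close>, the range on which the cosine decreases.\<close>
    proof (cases "r \<le> 1/2")
      case False
      then show ?thesis
        using torus_dist_le_half[of "x 0" y] \<open>N \<noteq> 0\<close> by (intro bexI[of _ "x 0"]) auto
    next
      case r: True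
      have r0: "r > 0" by (simp add: r_def)
      show ?thesis
      proof (rule ccontr)
        assume "\<not> ?thesis"
        then have far: "torus_dist (x j) y > r" if "j < N" for j
          using that by force
        define \<theta> where "\<theta> = pi / (real n + 1)"
        define a where "a j = sin (\<theta> * (real j + 1))" for j :: nat
        define A where "A = (\<Sum>j<n. (a j)\<^sup>2)"
        \<comment> \<open>Only \<open>n\<close> weights enter: the kernel has degree at most
          \<open>n - 1\<close>, leaving room for the cosine factor.\<close>
        define P where "P z = (\<Prod>i\<in>UNIV. fejer a n (z $ i))" for z :: "real ^ 'd"
        \<comment> \<open>The largest value of the sum of cosines when one coordinate is at distance
          at least \<open>r\<close> from the integers.\<close>
        define K where "K = real d - 1 + cos (2 * pi * r)"
        have \<theta>: "0 < \<theta>" "\<theta> < pi"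
          using n by (auto simp: \<theta>_def field_simps)
        have "A > 0"
        proof -
          have "a 0 > 0" using \<theta> by (auto simp: a_def intro: sin_gt_zero)
          then show ?thesis
            unfolding A_def using n by (intro sum_pos2[of _ 0]) auto
        qed
        have P: "trig_mean n (\<lambda>z. complex_of_real (P z)) (of_real (A ^ d))"
          unfolding P_def A_def d_def by (rule trig_mean_fejer) simp
        have Pcos: "trig_mean n (\<lambda>z. complex_of_real (cos (2 * pi * z $ i) * P z)) (of_real (cos \<theta> * A ^ d))" for i
          unfolding P_def A_def d_def
          by (rule trig_mean_cos_fejer) (simp, unfold a_def, rule sine_eigenvector[OF \<theta>_def])
        have "trig_mean n (\<lambda>z. (\<Sum>i\<in>UNIV. complex_of_real (cos (2 * pi * z $ i) * P z)) - of_real K * of_real (P z))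
            ((\<Sum>i\<in>(UNIV :: 'd set). of_real (cos \<theta> * A ^ d)) - of_real K * of_real (A ^ d))"
          by (intro trig_mean_diff trig_mean_sum trig_mean_cmult P Pcos)
        from trig_mean_shift[OF this, of y] mean
        have "(\<Sum>j<N. complex_of_real (w j) * ((\<Sum>i\<in>UNIV. of_real (cos (2 * pi * (x j - y) $ i) * P (x j - y)))
              - of_real K * of_real (P (x j - y)))) =
            (\<Sum>i\<in>(UNIV :: 'd set). of_real (cos \<theta> * A ^ d)) - of_real K * of_real (A ^ d)"
          by blast
        then have "complex_of_real (\<Sum>j<N. w j * ((\<Sum>i\<in>UNIV. cos (2 * pi * (x j - y) $ i) * P (x j - y)) - K * P (x j - y))) =
            of_real ((\<Sum>i\<in>(UNIV :: 'd set). cos \<theta> * A ^ d) - K * A ^ d)"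
          by simp
        then have "(\<Sum>j<N. w j * ((\<Sum>i\<in>UNIV. cos (2 * pi * (x j - y) $ i) * P (x j - y)) - K * P (x j - y))) =
            (\<Sum>i\<in>(UNIV :: 'd set). cos \<theta> * A ^ d) - K * A ^ d"
          by (simp only: of_real_eq_iff)
        also have "\<dots> = (real d * cos \<theta> - K) * A ^ d"
          by (simp add: d_def algebra_simps)
        also have "\<dots> > 0"
        proof -
          \<comment> \<open>With the doubling inequality this gives
            \<open>d * (1 - cos \<theta>) < 1 - cos (2 * pi * r)\<close>; the factor
            \<open>2 ^ (d - 1)\<close> in \<open>r\<close> originates here.\<close>
          have "real d < 2 ^ d" by simp
          then have "real d * (1 - cos \<theta>) < 2 ^ d * (1 - cos \<theta>)"
            using \<theta> cos_monotone_0_pi[of 0 \<theta>] by (intro mult_strict_right_mono) auto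
          also have "\<dots> \<le> 1 - cos (2 ^ d * \<theta>)"
          proof (rule one_minus_cos_double_le)
            have "2 ^ d * \<theta> = 2 * pi * r"
              using power_minus_mult[of d "2 :: real"] by (simp add: \<theta>_def r_def d_def field_simps)
            then show "2 ^ d * \<theta> \<le> pi" using r by simp
          qed (use \<theta> in simp)
          also have "2 ^ d * \<theta> = 2 * pi * r"
            using power_minus_mult[of d "2 :: real"] by (simp add: \<theta>_def r_def d_def field_simps)
          finally have "real d * cos \<theta> - K > 0" by (simp add: K_def algebra_simps)
          then show ?thesis using \<open>A > 0\<close> by simp
        qed
        finally have pos: "(\<Sum>j<N. w j * ((\<Sum>i\<in>UNIV. cos (2 * pi * (x j - y) $ i) * P (x j - y)) - K * P (x j - y))) > 0" .
        have "(\<Sum>j<N. w j * ((\<Sum>i\<in>UNIV. cos (2 * pi * (x j - y) $ i) * P (x j - y)) - K * P (x j - y))) \<le> 0"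
        proof (rule sum_nonpos)
          fix j assume "j \<in> {..<N}"
          then have j: "j < N" by simp
          define z where "z = x j - y"
          \<comment> \<open>After reduction by the nearest lattice point some coordinate
            \<open>t\<close> has modulus between \<open>r\<close> and \<open>1/2\<close>, where the
            cosine decreases in the modulus.\<close>
          define m :: "real ^ 'd" where "m = (\<chi> i. of_int (round (z $ i)))"
          have "r < torus_dist (x j) y" by (rule far[OF j])
          also have "\<dots> \<le> infnorm (z + - m)"
            unfolding z_def by (rule torus_dist_le) (simp add: m_def)
          finally obtain i0 where i0: "r < \<bar>z $ i0 - of_int (round (z $ i0))\<bar>"
            unfolding not_le[symmetric] infnorm_le_iff_cart by (auto simp: m_def)
          define t where "t = z $ i0 - of_int (round (z $ i0))"
          have t: "r < \<bar>t\<bar>" "\<bar>t\<bar> \<le> 1/2"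
            using i0 of_int_round_abs_le[of "z $ i0"] by (auto simp: t_def abs_minus_commute)
          have "cos (2 * pi * z $ i0) = cos (2 * pi * t)"
            by (simp add: t_def right_diff_distrib cos_diff)
          also have "\<dots> = cos \<bar>2 * pi * t\<bar>" by simp
          also have "\<dots> = cos (2 * pi * \<bar>t\<bar>)" by (simp add: abs_mult)
          also have "\<dots> \<le> cos (2 * pi * r)"
            using t r0 by (intro cos_monotone_0_pi_le) auto
          finally have i0': "cos (2 * pi * z $ i0) \<le> cos (2 * pi * r)" .
          have "(\<Sum>i\<in>UNIV. cos (2 * pi * z $ i)) = cos (2 * pi * z $ i0) + (\<Sum>i\<in>UNIV - {i0}. cos (2 * pi * z $ i))"
            by (rule sum.remove) auto
          also have "\<dots> \<le> cos (2 * pi * r) + (\<Sum>i\<in>UNIV - {i0}. 1)"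
            using i0' by (intro add_mono sum_mono) auto
          also have "\<dots> = K"
            by (simp add: K_def d_def of_nat_diff Suc_le_eq)
          finally have "((\<Sum>i\<in>UNIV. cos (2 * pi * z $ i)) - K) * P z \<le> 0"
            by (intro mult_nonpos_nonneg) (auto simp: P_def intro!: prod_nonneg fejer_nonneg)
          then have "w j * (((\<Sum>i\<in>UNIV. cos (2 * pi * z $ i)) - K) * P z) \<le> 0"
            by (rule mult_nonneg_nonpos[OF less_imp_le[OF w[OF j]]])
          then show "w j * ((\<Sum>i\<in>UNIV. cos (2 * pi * (x j - y) $ i) * P (x j - y)) - K * P (x j - y)) \<le> 0"
            by (simp only: z_def left_diff_distrib sum_distrib_right)
        qed
        with pos show False by simp
      qed
    qed
  qed
  then show ?thesis by (simp add: r_def d_def)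
qed

subsection \<open>Lifts, arc length and kernel estimates\<close>

lemma norm_cis_diff_le: "norm (cis a - cis b) \<le> \<bar>a - b\<bar>"
proof -
  have "cis a - cis b = cis b * (exp (\<i> * of_real (a - b)) - 1)"
    unfolding cis_conv_exp[symmetric] right_diff_distrib cis_mult by simp
  then have "norm (cis a - cis b) = 2 * \<bar>sin ((a - b) / 2)\<bar>"
    by (simp only: norm_mult norm_cis dist_exp_i_1)
  also have "\<dots> \<le> \<bar>a - b\<bar>"
    using abs_sin_x_le_abs_x[of "(a - b) / 2"] by simp
  finally show ?thesis .
qed

text \<open>On the unit circle integer shifts disappear, so continuity on the torus becomes ordinary
  continuity of circle-valued coordinates.\<close>

lemma norm_cis_component_diff_le:
  "norm (cis (2 * pi * x $ i) - cis (2 * pi * y $ i)) \<le> 2 * pi * torus_dist x y"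
proof -
  have "norm (cis (2 * pi * x $ i) - cis (2 * pi * y $ i)) / (2 * pi) \<le> torus_dist x y"
  proof (rule torus_dist_ge)
    fix z :: "real ^ 'a" assume z: "\<And>i. z $ i \<in> \<int>"
    have "cis (2 * pi * x $ i) = cis (2 * pi * x $ i + 2 * pi * z $ i)"
      unfolding cis_mult[symmetric] using z by simp
    then have "norm (cis (2 * pi * x $ i) - cis (2 * pi * y $ i)) \<le>
        \<bar>2 * pi * x $ i + 2 * pi * z $ i - 2 * pi * y $ i\<bar>"
      using norm_cis_diff_le by metis
    also have "\<dots> = \<bar>2 * pi * (x - y + z) $ i\<bar>"
      by (simp add: algebra_simps)
    also have "\<dots> \<le> 2 * pi * infnorm (x - y + z)"
      unfolding abs_mult using component_le_infnorm_cart[of "x - y + z" i] by simp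
    finally show "norm (cis (2 * pi * x $ i) - cis (2 * pi * y $ i)) / (2 * pi) \<le> infnorm (x - y + z)"
      by (simp add: field_simps)
  qed
  then show ?thesis by (simp add: field_simps)
qed

text \<open>Each coordinate gives a continuous nonvanishing map on a contractible interval and so
  has a continuous logarithm; its imaginary part over \<open>2 * pi\<close> is the lift.\<close>

lemma torus_curve_lift:
  fixes \<eta> :: "real \<Rightarrow> real ^ 'd"
  assumes "torus_continuous \<eta>"
  obtains \<Theta> where "continuous_on {0..1} \<Theta>" "\<And>t i. t \<in> {0..1} \<Longrightarrow> (\<Theta> t - \<eta> t) $ i \<in> \<int>"
proof -
  have "\<exists>\<theta>. continuous_on {0..1} \<theta> \<and> (\<forall>t\<in>{0..1}. \<theta> t - \<eta> t $ i \<in> \<int>)" for i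
  proof -
    have "continuous_on {0..1} (\<lambda>t. cis (2 * pi * \<eta> t $ i))"
      unfolding continuous_on_def
    proof
      fix t :: real assume "t \<in> {0..1}"
      then have "((\<lambda>s. 2 * pi * torus_dist (\<eta> s) (\<eta> t)) \<longlongrightarrow> 2 * pi * 0) (at t within {0..1})"
        using assms unfolding torus_continuous_def by (intro tendsto_mult_left) blast
      then have "((\<lambda>s. 2 * pi * torus_dist (\<eta> s) (\<eta> t)) \<longlongrightarrow> 0) (at t within {0..1})"
        by simp
      then have "((\<lambda>s. cis (2 * pi * \<eta> s $ i) - cis (2 * pi * \<eta> t $ i)) \<longlongrightarrow> 0) (at t within {0..1})"
        by (rule Lim_null_comparison[rotated]) (simp add: norm_cis_component_diff_le)
      then show "((\<lambda>s. cis (2 * pi * \<eta> s $ i)) \<longlongrightarrow> cis (2 * pi * \<eta> t $ i)) (at t within {0..1})"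
        by (rule LIM_zero_cancel)
    qed
    moreover have "contractible {0..1 :: real}"
      by (intro convex_imp_contractible) auto
    ultimately obtain h where h: "continuous_on {0..1} h" "\<And>t. t \<in> {0..1} \<Longrightarrow> cis (2 * pi * \<eta> t $ i) = exp (h t)"
      by (rule continuous_logarithm_on_contractible) auto
    show ?thesis
    proof (intro exI conjI ballI)
      show "continuous_on {0..1} (\<lambda>t. Im (h t) / (2 * pi))"
        by (intro continuous_intros h) auto
      fix t :: real assume "t \<in> {0..1}"
      then have "exp (h t) = exp (\<i> * of_real (2 * pi * \<eta> t $ i))"
        using h(2)[of t] by (simp only: cis_conv_exp)
      then obtain m :: int where "h t = \<i> * of_real (2 * pi * \<eta> t $ i) + (of_int (2 * m) * pi) * \<i>"
        unfolding exp_eq by blast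
      then have "Im (h t) = 2 * pi * \<eta> t $ i + 2 * m * pi" by simp
      then have "Im (h t) / (2 * pi) - \<eta> t $ i = of_int m" by (simp add: field_simps)
      then show "Im (h t) / (2 * pi) - \<eta> t $ i \<in> \<int>" by simp
    qed
  qed
  then have "\<forall>i. \<exists>\<theta>. continuous_on {0..1} \<theta> \<and> (\<forall>t\<in>{0..1}. \<theta> t - \<eta> t $ i \<in> \<int>)"
    by blast
  from choice[OF this] obtain \<theta>
    where \<theta>: "\<And>i. continuous_on {0..1} (\<theta> i)" "\<And>i t. t \<in> {0..1} \<Longrightarrow> \<theta> i t - \<eta> t $ i \<in> \<int>"
    by blast
  show ?thesis
  proof (rule that)
    show "continuous_on {0..1} (\<lambda>t. \<chi> i. \<theta> i t)"
      by (intro continuous_intros \<theta>)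
  qed (use \<theta>(2) in simp)
qed

text \<open>Continuity of the lift makes the linearisation error eventually smaller than
  \<open>1/2\<close>, where torus distance and maximum norm coincide. Passing to the Euclidean norm
  costs only a constant factor.\<close>

lemma has_torus_derivative_lift:
  fixes \<eta> \<Theta> :: "real \<Rightarrow> real ^ 'd"
  assumes cont: "continuous_on {0..1} \<Theta>" and lift: "\<And>t i. t \<in> {0..1} \<Longrightarrow> (\<Theta> t - \<eta> t) $ i \<in> \<int>"
    and t: "t \<in> {0..1}" and der: "has_torus_derivative \<eta> v t"
  shows "(\<Theta> has_vector_derivative v) (at t within {0..1})"
proof -
  define F where "F = at t within {0..1}"
  define e where "e s = \<Theta> s - (\<Theta> t + (s - t) *\<^sub>R v)" for s
  have F: "eventually (\<lambda>s. s \<in> {0..1} \<and> s \<noteq> t) F"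
    by (auto simp: F_def eventually_at_filter)
  have "(\<Theta> \<longlongrightarrow> \<Theta> t) F"
    using cont t by (simp add: continuous_on_def F_def)
  then have "(e \<longlongrightarrow> \<Theta> t - (\<Theta> t + (t - t) *\<^sub>R v)) F"
    unfolding e_def F_def by (intro tendsto_intros)
  then have "((\<lambda>s. norm (e s)) \<longlongrightarrow> 0) F"
    by (simp add: tendsto_norm_zero)
  then have small: "eventually (\<lambda>s. norm (e s) < 1/2) F"
    by (rule order_tendstoD) simp
  have "((\<lambda>s. sqrt (DIM(real ^ 'd)) * (torus_dist (\<eta> s) (\<eta> t + (s - t) *\<^sub>R v) / \<bar>s - t\<bar>)) \<longlongrightarrow>
      sqrt (DIM(real ^ 'd)) * 0) F"
    using der unfolding has_torus_derivative_def F_def by (rule tendsto_mult_left)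
  then have "((\<lambda>s. sqrt (DIM(real ^ 'd)) * (torus_dist (\<eta> s) (\<eta> t + (s - t) *\<^sub>R v) / \<bar>s - t\<bar>)) \<longlongrightarrow> 0) F"
    by simp
  then have lim: "((\<lambda>s. e s /\<^sub>R \<bar>s - t\<bar>) \<longlongrightarrow> 0) F"
  proof (rule Lim_null_comparison[rotated])
    show "eventually (\<lambda>s. norm (e s /\<^sub>R \<bar>s - t\<bar>) \<le>
        sqrt (DIM(real ^ 'd)) * (torus_dist (\<eta> s) (\<eta> t + (s - t) *\<^sub>R v) / \<bar>s - t\<bar>)) F"
      using small F
    proof eventually_elim
      case (elim s)
      have "infnorm (e s) \<le> 1/2"
        using infnorm_le_norm[of "e s"] elim(1) by linarith
      then have "infnorm (e s) = torus_dist (\<Theta> s) (\<Theta> t + (s - t) *\<^sub>R v)"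
        unfolding e_def by (rule torus_dist_eq_infnorm[symmetric])
      also have "\<dots> = torus_dist (\<eta> s) (\<eta> t + (s - t) *\<^sub>R v)"
        using lift[OF t] lift[of s] elim(2) by (intro torus_dist_cong) (simp_all add: algebra_simps)
      finally have "norm (e s) \<le> sqrt (DIM(real ^ 'd)) * torus_dist (\<eta> s) (\<eta> t + (s - t) *\<^sub>R v)"
        using norm_le_infnorm[of "e s"] by simp
      then have "norm (e s) / \<bar>s - t\<bar> \<le> sqrt (DIM(real ^ 'd)) * torus_dist (\<eta> s) (\<eta> t + (s - t) *\<^sub>R v) / \<bar>s - t\<bar>"
        by (rule divide_right_mono) simp
      then show ?case by (simp add: divide_inverse mult_ac)
    qed
  qed
  have "((\<lambda>s. (\<Theta> s - \<Theta> t - (s - t) *\<^sub>R v) /\<^sub>R norm (s - t)) \<longlongrightarrow> 0) F"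
    using lim by (simp add: e_def diff_diff_add)
  then show ?thesis
    unfolding has_vector_derivative_def has_derivative_at_within F_def
    by (simp add: bounded_linear_scaleR_left)
qed

text \<open>The strong fundamental theorem of calculus for the gauge integral yields integrability
  of \<open>v\<close> together with its integral, tolerating the exceptional set \<open>S\<close>;
  then the norm is taken inside.\<close>

lemma curve_displacement_le:
  fixes \<Theta> :: "real \<Rightarrow> real ^ 'd"
  assumes "finite S" "continuous_on {0..1} \<Theta>"
    and der: "\<And>t. t \<in> {0..1} - S \<Longrightarrow> (\<Theta> has_vector_derivative v t) (at t within {0..1})"
    and int: "(\<lambda>t. norm (v t)) integrable_on {0..1}"
    and st: "0 \<le> s" "s \<le> t" "t \<le> 1"
  shows "norm (\<Theta> t - \<Theta> s) \<le> integral {0..t} (\<lambda>t. norm (v t)) - integral {0..s} (\<lambda>t. norm (v t))"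
proof -
  have hi: "(v has_integral (\<Theta> t - \<Theta> s)) {s..t}"
  proof (rule fundamental_theorem_of_calculus_interior_strong[OF assms(1) st(2)])
    show "continuous_on {s..t} \<Theta>"
      using assms(2) by (rule continuous_on_subset) (use st in auto)
    fix x assume x: "x \<in> {s<..<t} - S"
    then have "(\<Theta> has_vector_derivative v x) (at x within {0..1})"
      using st by (intro der) auto
    moreover have "at x within {0..1} = at x"
      using x st by (intro at_within_interior) auto
    ultimately show "(\<Theta> has_vector_derivative v x) (at x)" by simp
  qed
  have sub: "(\<lambda>t. norm (v t)) integrable_on {s..t}"
    by (rule integrable_subinterval_real[OF int]) (use st in auto)
  have "norm (\<Theta> t - \<Theta> s) \<le> integral {s..t} (\<lambda>t. norm (v t))"
    using Henstock_Kurzweil_Integration.integral_norm_bound_integral[OF has_integral_integrable[OF hi] sub]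
      integral_unique[OF hi] by simp
  also have "\<dots> = integral {0..t} (\<lambda>t. norm (v t)) - integral {0..s} (\<lambda>t. norm (v t))"
    using Henstock_Kurzweil_Integration.integral_combine[of 0 s t "\<lambda>t. norm (v t)"] integrable_subinterval_real[OF int, of 0 t] st by auto
  finally show ?thesis .
qed

text \<open>A weighted form of substitution that avoids differentiating the indefinite integral of \<open>\<rho>\<close>:
  a set of parameters on which the arc length runs through an interval carries the mass of that
  interval.\<close>

lemma integral_weighted_windows_ge:
  fixes g \<rho> :: "real \<Rightarrow> real"
  defines "A \<equiv> \<lambda>u. integral {0..u} \<rho>"
  assumes \<rho>: "\<rho> integrable_on {0..1}" "\<And>u. u \<in> {0..1} \<Longrightarrow> \<rho> u \<ge> 0"
    and g: "(\<lambda>u. g u * \<rho> u) integrable_on {0..1}" "\<And>u. u \<in> {0..1} \<Longrightarrow> g u \<ge> 0"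
    and window: "\<And>u. u \<in> {0..1} \<Longrightarrow> A u \<in> {a..b} \<union> {c..d} \<Longrightarrow> g u \<ge> K"
    and order: "0 \<le> a" "a \<le> b" "b \<le> c" "c \<le> d" "d \<le> A 1"
  shows "K * ((b - a) + (d - c)) \<le> integral {0..1} (\<lambda>u. g u * \<rho> u)"
proof -
  have comb: "integral {u..v} f + integral {v..w} f = integral {u..w} f"
    if "f integrable_on {0..1}" "0 \<le> u" "u \<le> v" "v \<le> w" "w \<le> 1" for f :: "real \<Rightarrow> real" and u v w
    using that by (intro Henstock_Kurzweil_Integration.integral_combine integrable_subinterval_real[OF that(1)]) auto
  have A_diff: "integral {u..v} \<rho> = A v - A u" if "0 \<le> u" "u \<le> v" "v \<le> 1" for u v
    using comb[OF \<rho>(1), of 0 u v] that by (simp add: A_def)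
  have A_mono: "A u \<le> A v" if "0 \<le> u" "u \<le> v" "v \<le> 1" for u v
  proof -
    have "0 \<le> integral {u..v} \<rho>"
      by (intro integral_nonneg integrable_subinterval_real[OF \<rho>(1)] \<rho>(2)) (use that in auto)
    then show ?thesis using A_diff[OF that] by simp
  qed
  have ge: "L * (A v - A u) \<le> integral {u..v} (\<lambda>u. g u * \<rho> u)"
    if uv: "0 \<le> u" "u \<le> v" "v \<le> 1" and L: "\<And>x. x \<in> {u..v} \<Longrightarrow> L \<le> g x" for u v L
  proof -
    have "L * (A v - A u) = integral {u..v} (\<lambda>x. L * \<rho> x)"
      by (simp add: A_diff[OF uv])
    also have "\<dots> \<le> integral {u..v} (\<lambda>u. g u * \<rho> u)"
    proof (rule integral_le)
      show "(\<lambda>x. L * \<rho> x) integrable_on {u..v}"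
        by (intro integrable_on_mult_right integrable_subinterval_real[OF \<rho>(1)]) (use uv in auto)
      show "(\<lambda>u. g u * \<rho> u) integrable_on {u..v}"
        by (rule integrable_subinterval_real[OF g(1)]) (use uv in auto)
    qed (use uv L \<rho>(2) in \<open>auto intro!: mult_right_mono\<close>)
    finally show ?thesis .
  qed
  have ivt: "\<exists>u\<ge>0. u \<le> v \<and> A u = y" if "0 \<le> v" "v \<le> 1" "0 \<le> y" "y \<le> A v" for v y
  proof -
    have "continuous_on {0..1} A"
      unfolding A_def by (rule indefinite_integral_continuous_1[OF \<rho>(1)])
    then have "continuous_on {0..v} A"
      by (rule continuous_on_subset) (use that in auto)
    moreover have "A 0 = 0" by (simp add: A_def)
    ultimately show ?thesis
      using IVT'[of A 0 y v] that by auto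
  qed
  \<comment> \<open>The parameters are found from right to left, each below the previous one;
    monotonicity keeps \<open>A\<close> within the window between two of them.\<close>
  obtain u4 where u4: "u4 \<ge> 0" "u4 \<le> 1" "A u4 = d"
    using ivt[of 1 d] order by auto
  obtain u3 where u3: "u3 \<ge> 0" "u3 \<le> u4" "A u3 = c"
    using ivt[of u4 c] order u4 by auto
  obtain u2 where u2: "u2 \<ge> 0" "u2 \<le> u3" "A u2 = b"
    using ivt[of u3 b] order u3 u4 by auto
  obtain u1 where u1: "u1 \<ge> 0" "u1 \<le> u2" "A u1 = a"
    using ivt[of u2 a] order u2 u3 u4 by auto
  note u = u1 u2 u3 u4
  have "K * (A u2 - A u1) \<le> integral {u1..u2} (\<lambda>u. g u * \<rho> u)"
  proof (rule ge)
    fix x assume x: "x \<in> {u1..u2}"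
    then have "A x \<in> {a..b}" using A_mono[of u1 x] A_mono[of x u2] u by auto
    then show "K \<le> g x" using window[of x] u x by auto
  qed (use u in auto)
  moreover have "K * (A u4 - A u3) \<le> integral {u3..u4} (\<lambda>u. g u * \<rho> u)"
  proof (rule ge)
    fix x assume x: "x \<in> {u3..u4}"
    then have "A x \<in> {c..d}" using A_mono[of u3 x] A_mono[of x u4] u by auto
    then show "K \<le> g x" using window[of x] u x by auto
  qed (use u in auto)
  \<comment> \<open>Outside the windows only the nonnegativity of \<open>g\<close> enters.\<close>
  moreover have "0 * (A u1 - A 0) \<le> integral {0..u1} (\<lambda>u. g u * \<rho> u)"
    by (rule ge) (use u g(2) in auto)
  moreover have "0 * (A u3 - A u2) \<le> integral {u2..u3} (\<lambda>u. g u * \<rho> u)"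
    by (rule ge) (use u g(2) in auto)
  moreover have "0 * (A 1 - A u4) \<le> integral {u4..1} (\<lambda>u. g u * \<rho> u)"
    by (rule ge) (use u g(2) in auto)
  moreover have "integral {0..1} (\<lambda>u. g u * \<rho> u) =
      integral {0..u1} (\<lambda>u. g u * \<rho> u) + integral {u1..u2} (\<lambda>u. g u * \<rho> u) + integral {u2..u3} (\<lambda>u. g u * \<rho> u)
        + integral {u3..u4} (\<lambda>u. g u * \<rho> u) + integral {u4..1} (\<lambda>u. g u * \<rho> u)"
    using comb[OF g(1), of 0 u1 u2] comb[OF g(1), of 0 u2 u3] comb[OF g(1), of 0 u3 u4] comb[OF g(1), of 0 u4 1] u
    by auto
  ultimately show ?thesis
    by (simp add: u algebra_simps)
qed

section \<open>Lower bounds for the uniformly weighted Fejer kernel\<close>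

lemma one_minus_le_cos: "1 - x\<^sup>2 / 2 \<le> cos (x :: real)"
proof -
  have "(sin (x / 2))\<^sup>2 \<le> (x / 2)\<^sup>2"
    using abs_sin_x_le_abs_x[of "x / 2"] by (simp only: abs_le_square_iff)
  moreover have "cos x = 1 - 2 * (sin (x / 2))\<^sup>2"
    using cos_double_sin[of "x / 2"] by simp
  ultimately show ?thesis by (simp add: power_divide)
qed

text \<open>Up to normalisation this is the curvature of the uniform Fejer kernel at 0.\<close>

lemma sum_square_diff:
  "(\<Sum>j<N. \<Sum>l<N. (real j - real l)\<^sup>2) = (real N)\<^sup>2 * ((real N)\<^sup>2 - 1) / 6"
proof -
  have s1: "(\<Sum>j<N. real j) = real N * (real N - 1) / 2"
    by (induction N) (auto simp: field_simps)
  have s2: "(\<Sum>j<N. (real j)\<^sup>2) = real N * (real N - 1) * (2 * real N - 1) / 6"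
    by (induction N) (auto simp: field_simps power2_eq_square)
  have "(\<Sum>j<N. \<Sum>l<N. (real j - real l)\<^sup>2) =
      (\<Sum>j<N. \<Sum>l<N. (real j)\<^sup>2) + (\<Sum>j<N. \<Sum>l<N. (real l)\<^sup>2) - 2 * (\<Sum>j<N. \<Sum>l<N. real j * real l)"
    by (simp add: power2_diff sum.distrib sum_subtractf sum_distrib_left mult.assoc)
  also have "(\<Sum>j<N. \<Sum>l<N. real j * real l) = (\<Sum>j<N. real j) * (\<Sum>l<N. real l)"
    by (simp add: sum_product)
  also have "(\<Sum>j<N. \<Sum>l<N. (real j)\<^sup>2) + (\<Sum>j<N. \<Sum>l<N. (real l)\<^sup>2) = 2 * real N * (\<Sum>j<N. (real j)\<^sup>2)"
    by (simp add: sum_distrib_left mult_ac)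
  finally show ?thesis
    unfolding s1 s2 by (simp add: field_simps power2_eq_square)
qed

text \<open>The upper bound is the triangle inequality. For the lower one each cosine in the
  expansion is replaced by its second-order Taylor polynomial, and the resulting factor
  \<open>N\<^sup>2 - 1\<close> is enlarged to \<open>N\<^sup>2\<close>.\<close>

lemma fejer_uniform_bounds:
  fixes N :: nat
  assumes "N \<ge> 1"
  defines "f \<equiv> fejer (\<lambda>_. 1 / real N) N"
  shows "f t \<le> 1" "1 - (N * pi * t)\<^sup>2 / 3 \<le> f t"
proof -
  have "norm (\<Sum>j<N. complex_of_real (1 / real N) * cis (2 * pi * real j * t)) \<le> (\<Sum>j<N. 1 / real N)"
    by (rule sum_norm_le) (simp add: norm_mult norm_divide)
  also have "\<dots> = 1" using assms(1) by simp
  finally show "f t \<le> 1"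
    unfolding f_def fejer_def by (rule power_le_one[OF norm_ge_zero])
  have "f t = Re (complex_of_real (f t))" by simp
  also have "\<dots> = (\<Sum>j<N. \<Sum>l<N. 1 / (real N)\<^sup>2 * cos (2 * pi * (real j - real l) * t))"
    unfolding f_def fejer_expand Re_sum by (simp add: power2_eq_square)
  also have "\<dots> \<ge> (\<Sum>j<N. \<Sum>l<N. 1 / (real N)\<^sup>2 * (1 - (2 * pi * (real j - real l) * t)\<^sup>2 / 2))"
    by (intro sum_mono mult_left_mono one_minus_le_cos) auto
  also have "(\<Sum>j<N. \<Sum>l<N. 1 / (real N)\<^sup>2 * (1 - (2 * pi * (real j - real l) * t)\<^sup>2 / 2)) =
      1 / (real N)\<^sup>2 * (\<Sum>j<N. \<Sum>l<N. 1 - 2 * pi\<^sup>2 * t\<^sup>2 * (real j - real l)\<^sup>2)"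
    unfolding sum_distrib_left by (intro sum.cong refl) (simp add: power_mult_distrib)
  also have "\<dots> = 1 / (real N)\<^sup>2 * ((real N)\<^sup>2 - 2 * pi\<^sup>2 * t\<^sup>2 * (\<Sum>j<N. \<Sum>l<N. (real j - real l)\<^sup>2))"
    by (simp add: sum_subtractf sum_distrib_left power2_eq_square)
  also have "\<dots> = 1 - pi\<^sup>2 * t\<^sup>2 * ((real N)\<^sup>2 - 1) / 3"
    unfolding sum_square_diff using assms(1) by (simp add: field_simps)
  finally have "1 - pi\<^sup>2 * t\<^sup>2 * ((real N)\<^sup>2 - 1) / 3 \<le> f t" .
  moreover have "pi\<^sup>2 * t\<^sup>2 * ((real N)\<^sup>2 - 1) \<le> (N * pi * t)\<^sup>2"
    by (simp add: power_mult_distrib algebra_simps)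
  ultimately show "1 - (N * pi * t)\<^sup>2 / 3 \<le> f t" by simp
qed

text \<open>The Weierstrass product inequality; the induction step is
  \<open>(1 - f i) * (1 - p) \<ge> 0\<close> with \<open>p\<close> the remaining product.\<close>

lemma one_minus_sum_le_prod:
  fixes f :: "'a \<Rightarrow> real"
  assumes "finite I" "\<And>i. i \<in> I \<Longrightarrow> 0 \<le> f i \<and> f i \<le> 1"
  shows "1 - (\<Sum>i\<in>I. 1 - f i) \<le> (\<Prod>i\<in>I. f i)"
  using assms
proof (induction I rule: finite_induct)
  case (insert i I)
  have p: "(\<Prod>i\<in>I. f i) \<le> 1" by (intro prod_le_1) (use insert.prems in auto)
  have "0 \<le> (1 - f i) * (1 - (\<Prod>i\<in>I. f i))"
    using insert.prems p by (intro mult_nonneg_nonneg) auto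
  then have "f i + (\<Prod>i\<in>I. f i) - 1 \<le> f i * (\<Prod>i\<in>I. f i)"
    by (simp add: algebra_simps)
  then show ?case using insert by auto
qed simp

text \<open>The losses \<open>(N * pi * x $ i)\<^sup>2 / 3\<close> of the coordinates add up to a
  multiple of the squared Euclidean norm, so the radius is independent of the dimension and
  comparable with arc length.\<close>

lemma fejer_prod_ge:
  fixes x :: "real ^ 'd"
  assumes "N \<ge> 1" "norm x \<le> 1 / (real N * pi)"
  shows "2/3 \<le> (\<Prod>i\<in>UNIV. fejer (\<lambda>_. 1 / real N) N (x $ i))"
proof -
  have sq: "(norm x)\<^sup>2 = (\<Sum>i\<in>UNIV. (x $ i)\<^sup>2)"
    unfolding power2_norm_eq_inner inner_vec_def by (simp add: power2_eq_square)
  have "(real N * pi)\<^sup>2 * (norm x)\<^sup>2 \<le> 1"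
  proof -
    have "real N * pi * norm x \<le> 1" using assms by (simp add: field_simps)
    then have "(real N * pi * norm x)\<^sup>2 \<le> 1" by (intro power_le_one) auto
    then show ?thesis by (simp add: power_mult_distrib)
  qed
  then have "2/3 \<le> 1 - (\<Sum>i\<in>UNIV. (N * pi * x $ i)\<^sup>2 / 3)"
    unfolding sq by (simp add: power_mult_distrib sum_distrib_left flip: sum_divide_distrib)
  also have "\<dots> \<le> 1 - (\<Sum>i\<in>UNIV. 1 - fejer (\<lambda>_. 1 / real N) N (x $ i))"
  proof (intro diff_left_mono sum_mono)
    fix i
    show "1 - fejer (\<lambda>_. 1 / real N) N (x $ i) \<le> (N * pi * x $ i)\<^sup>2 / 3"
      using fejer_uniform_bounds(2)[OF assms(1), of "x $ i"] by linarith
  qed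
  also have "\<dots> \<le> (\<Prod>i\<in>UNIV. fejer (\<lambda>_. 1 / real N) N (x $ i))"
    using fejer_uniform_bounds(1)[OF assms(1)] by (intro one_minus_sum_le_prod) (auto simp: fejer_nonneg)
  finally show ?thesis .
qed

subsection \<open>Length of exact curves\<close>

text \<open>Testing with \<open>f = 1\<close>. Since \<open>1 / 0 = 0\<close>, a curve of length 0
  would give \<open>0 = 1\<close>.\<close>

lemma curve_exact_nonzero:
  fixes \<eta> :: "real \<Rightarrow> real ^ 'd"
  assumes "curve_exact n \<eta> w"
  shows "curve_length \<eta> \<noteq> 0" "curve_integral \<eta> (\<lambda>x. of_real (w x)) = of_real (curve_length \<eta>)"
proof -
  have "trig_mean n (character (0 :: int ^ 'd)) 1"
    using trig_mean_character[of "0 :: int ^ 'd" n] by simp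
  then have "1 / of_real (curve_length \<eta>) * curve_integral \<eta> (\<lambda>x. character 0 x * of_real (w x)) = 1"
    using assms unfolding curve_exact_def trig_mean_def by metis
  then have eq: "1 / of_real (curve_length \<eta>) * curve_integral \<eta> (\<lambda>x. of_real (w x)) = 1"
    by simp
  show "curve_length \<eta> \<noteq> 0"
  proof
    assume "curve_length \<eta> = 0"
    with eq show False by simp
  qed
  then show "curve_integral \<eta> (\<lambda>x. of_real (w x)) = of_real (curve_length \<eta>)"
    using eq by (simp add: field_simps)
qed

text \<open>A non-integrable speed would have integral 0 by convention.\<close>

lemma curve_length_nonzero_integrable:
  assumes "curve_length \<eta> \<noteq> 0"
  shows "set_integrable lebesgue {0..1} (\<lambda>t. norm (torus_velocity \<eta> t))"
  using assms not_integrable_integral_eq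
  unfolding curve_length_def set_lebesgue_integral_def set_integrable_def by blast

text \<open>The lift is continuous in the usual sense, so it can be recovered by integrating its
  velocity, and arc length dominates its displacement.\<close>

lemma torus_curve_arc_length:
  fixes \<eta> :: "real \<Rightarrow> real ^ 'd"
  defines "A \<equiv> \<lambda>u. integral {0..u} (\<lambda>t. norm (torus_velocity \<eta> t))"
  assumes cont: "torus_continuous \<eta>" and diff: "torus_piecewise_differentiable \<eta>"
    and len: "curve_length \<eta> \<noteq> 0"
  obtains \<Theta> where "continuous_on {0..1} \<Theta>" "\<And>t i. t \<in> {0..1} \<Longrightarrow> (\<Theta> t - \<eta> t) $ i \<in> \<int>"
    "\<And>s t. 0 \<le> s \<Longrightarrow> s \<le> t \<Longrightarrow> t \<le> 1 \<Longrightarrow> norm (\<Theta> t - \<Theta> s) \<le> A t - A s"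
proof -
  obtain \<Theta> where \<Theta>: "continuous_on {0..1} \<Theta>" "\<And>t i. t \<in> {0..1} \<Longrightarrow> (\<Theta> t - \<eta> t) $ i \<in> \<int>"
    using torus_curve_lift[OF cont] by metis
  obtain S where S: "finite S" "\<And>t. t \<in> {0..1} - S \<Longrightarrow> \<exists>v. has_torus_derivative \<eta> v t"
    using diff unfolding torus_piecewise_differentiable_def by auto
  have der: "(\<Theta> has_vector_derivative torus_velocity \<eta> t) (at t within {0..1})" if t: "t \<in> {0..1} - S" for t
  proof -
    obtain v where "has_torus_derivative \<eta> v t" using S(2)[OF t] by blast
    then have "has_torus_derivative \<eta> (torus_velocity \<eta> t) t"
      by (rule has_torus_derivative_velocity)
    then show ?thesis
      using \<Theta> t by (intro has_torus_derivative_lift[of \<Theta> \<eta>]) auto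
  qed
  have "(\<lambda>t. norm (torus_velocity \<eta> t)) integrable_on {0..1}"
    using curve_length_nonzero_integrable[OF len] by (rule set_lebesgue_integral_eq_integral)
  from curve_displacement_le[OF S(1) \<Theta>(1) der this] show ?thesis
    using that[OF \<Theta>] unfolding A_def by blast
qed

lemma curve_length_eq_integral:
  assumes "curve_length \<eta> \<noteq> 0"
  shows "curve_length \<eta> = integral {0..1} (\<lambda>t. norm (torus_velocity \<eta> t))"
  unfolding curve_length_def
  using curve_length_nonzero_integrable[OF assms] by (rule set_lebesgue_integral_eq_integral)

text \<open>A coordinate of the lifted curve sweeps out an interval; a point whose coordinate is
  antipodal to the midpoint of this interval is far from the curve if the interval is short.\<close>

lemma curve_length_ge_covering:
  fixes \<eta> :: "real \<Rightarrow> real ^ 'd"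
  assumes cont: "torus_continuous \<eta>" and diff: "torus_piecewise_differentiable \<eta>"
    and len: "curve_length \<eta> \<noteq> 0"
  shows "1 - 2 * covering_radius (\<eta> ` {0..1}) \<le> curve_length \<eta>"
proof -
  define A where "A = (\<lambda>u. integral {0..u} (\<lambda>t. norm (torus_velocity \<eta> t)))"
  obtain \<Theta> where \<Theta>: "continuous_on {0..1} \<Theta>" "\<And>t i. t \<in> {0..1} \<Longrightarrow> (\<Theta> t - \<eta> t) $ i \<in> \<int>"
    and disp: "\<And>s t. 0 \<le> s \<Longrightarrow> s \<le> t \<Longrightarrow> t \<le> 1 \<Longrightarrow> norm (\<Theta> t - \<Theta> s) \<le> A t - A s"
    using torus_curve_arc_length[OF cont diff len] unfolding A_def by metis
  \<comment> \<open>Any coordinate will do; index types are nonempty.\<close>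
  obtain i :: 'd where True by simp
  have ci: "continuous_on {0..1} (\<lambda>t. \<Theta> t $ i)"
    by (intro continuous_intros \<Theta>)
  obtain u where u: "u \<in> {0..1}" "\<And>t. t \<in> {0..1} \<Longrightarrow> \<Theta> u $ i \<le> \<Theta> t $ i"
    using continuous_attains_inf[OF compact_Icc _ ci] by auto
  obtain v where v: "v \<in> {0..1}" "\<And>t. t \<in> {0..1} \<Longrightarrow> \<Theta> t $ i \<le> \<Theta> v $ i"
    using continuous_attains_sup[OF compact_Icc _ ci] by auto
  define m where "m = (\<Theta> u $ i + \<Theta> v $ i) / 2"
  define r where "r = (\<Theta> v $ i - \<Theta> u $ i) / 2"
  have A01: "A 0 = 0" "A 1 = curve_length \<eta>"
    by (simp_all add: A_def curve_length_eq_integral[OF len])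
  have mono: "A s \<le> A t" if "0 \<le> s" "s \<le> t" "t \<le> 1" for s t
    using disp[OF that] norm_ge_zero[of "\<Theta> t - \<Theta> s"] by linarith
  have "2 * r \<le> norm (\<Theta> v - \<Theta> u)"
    using component_le_norm_cart[of "\<Theta> v - \<Theta> u" i] by (simp add: r_def)
  also have "\<dots> \<le> \<bar>A v - A u\<bar>"
  proof (cases "u \<le> v")
    case True
    then show ?thesis using disp[of u v] u(1) v(1) by auto
  next
    case False
    then show ?thesis using disp[of v u] u(1) v(1) by (auto simp: norm_minus_commute)
  qed
  also have "\<dots> \<le> curve_length \<eta>"
    using mono[of 0 u] mono[of 0 v] mono[of u 1] mono[of v 1] u(1) v(1) A01 by auto
  finally have len_ge: "2 * r \<le> curve_length \<eta>" .
  \<comment> \<open>\<open>frac\<close> brings \<open>m + 1/2\<close>, the antipode of the midpoint,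
    into \<open>[0,1)\<close>.\<close>
  define x :: "real ^ 'd" where "x = (\<chi> j. if j = i then frac (m + 1/2) else 0)"
  have "1/2 - r \<le> covering_radius (\<eta> ` {0..1})"
  proof (rule covering_radius_ge)
    show "x \<in> torus" by (auto simp: x_def torus_def frac_lt_1)
    fix y assume "y \<in> \<eta> ` {0..1}"
    then obtain t where t: "t \<in> {0..1}" "y = \<eta> t" by blast
    show "1/2 - r \<le> torus_dist y x"
    proof (rule torus_dist_ge)
      fix z :: "real ^ 'd" assume z: "\<And>i. z $ i \<in> \<int>"
      have "y $ i - frac (m + 1/2) + z $ i - (\<Theta> t $ i - m - 1/2) = z $ i + of_int \<lfloor>m + 1/2\<rfloor> - (\<Theta> t - \<eta> t) $ i"
        by (simp add: t frac_def)
      also have "\<dots> \<in> \<int>"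
        using z \<Theta>(2)[OF t(1)] by (intro Ints_diff Ints_add) auto
      finally obtain j where j: "y $ i - frac (m + 1/2) + z $ i = \<Theta> t $ i - m - 1/2 + of_int j"
        by (auto elim!: Ints_cases simp: algebra_simps)
      have c: "\<bar>\<Theta> t $ i - m\<bar> \<le> r"
        using u(2)[OF t(1)] v(2)[OF t(1)] by (auto simp: m_def r_def field_simps abs_le_iff)
      have "1/2 \<le> \<bar>of_int j - 1/2 :: real\<bar>"
      proof (cases "j \<le> 0")
        case False
        then have "real_of_int 1 \<le> real_of_int j" by (subst of_int_le_iff) simp
        then show ?thesis by simp
      qed simp
      then have "1/2 - r \<le> \<bar>y $ i - frac (m + 1/2) + z $ i\<bar>"
        unfolding j using c by linarith
      also have "\<dots> \<le> infnorm (y - x + z)"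
        using component_le_infnorm_cart[of "y - x + z" i] by (simp add: x_def)
      finally show "1/2 - r \<le> infnorm (y - x + z)" .
    qed
  qed simp
  with len_ge show ?thesis by simp
qed

text \<open>The average of \<open>P (y - \<eta> u)\<close> over the curve is itself a trigonometric polynomial in \<open>y\<close>, to
  which the exactness of the quadrature along \<open>\<eta>\<close> applies.\<close>

lemma trig_mean_curve_average:
  fixes \<eta> :: "real \<Rightarrow> real ^ 'd" and P :: "real ^ 'd \<Rightarrow> real"
  assumes cont: "torus_continuous \<eta>" and len: "curve_length \<eta> \<noteq> 0"
    and P: "trig_mean n (\<lambda>x. complex_of_real (P x)) (of_real \<mu>)"
  defines "F \<equiv> \<lambda>y. LINT u:{0..1}|lebesgue. P (y - \<eta> u) * norm (torus_velocity \<eta> u)"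
  shows "trig_mean n (\<lambda>y. complex_of_real (F y)) (of_real (\<mu> * curve_length \<eta>))"
    and "set_integrable lebesgue {0..1} (\<lambda>u. P (y - \<eta> u) * norm (torus_velocity \<eta> u))"
proof -
  define \<rho> where "\<rho> u = norm (torus_velocity \<eta> u)" for u
  define I where "I = {k :: int ^ 'd. \<forall>i. \<bar>k $ i\<bar> \<le> int n}"
  have \<rho>: "set_integrable lebesgue {0..1} \<rho>"
    unfolding \<rho>_def by (rule curve_length_nonzero_integrable[OF len])
  obtain c where c: "(\<lambda>x. complex_of_real (P x)) = (\<lambda>x. \<Sum>k\<in>I. c k * character k x)" "c 0 = of_real \<mu>"
    using P unfolding trig_mean_altdef I_def by blast
  obtain \<Theta> where \<Theta>: "continuous_on {0..1} \<Theta>" "\<And>t i. t \<in> {0..1} \<Longrightarrow> (\<Theta> t - \<eta> t) $ i \<in> \<int>"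
    using torus_curve_lift[OF cont] by metis
  have int: "set_integrable lebesgue {0..1} (\<lambda>u. character k (- \<eta> u) * complex_of_real (\<rho> u))" for k
  proof -
    \<comment> \<open>Measurability is taken from the continuous lift: characters do not see integer
      shifts, while \<open>\<eta>\<close> itself may jump by integers.\<close>
    have "set_borel_measurable lebesgue {0..1} (\<lambda>u. character k (- \<Theta> u))"
    proof -
      have "set_borel_measurable borel {0..1} (\<lambda>u. character k (- \<Theta> u))"
        unfolding set_borel_measurable_def
        by (intro borel_measurable_continuous_on_indicator continuous_intros \<Theta>) auto
      then show ?thesis
        unfolding set_borel_measurable_def by (intro measurable_completion) simp
    qed
    moreover have "indicator {0..1} u *\<^sub>R character k (- \<eta> u) = indicator {0..1} u *\<^sub>R character k (- \<Theta> u)" for u :: real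
    proof (cases "u \<in> {0..1}")
      case True
      then show ?thesis using \<Theta>(2)[OF True] character_cong[of "- \<eta> u" "- \<Theta> u" k] by simp
    qed simp
    ultimately have [measurable]: "(\<lambda>u. indicator {0..1} u *\<^sub>R character k (- \<eta> u)) \<in> borel_measurable lebesgue"
      unfolding set_borel_measurable_def by presburger
    have "integrable lebesgue (\<lambda>u. complex_of_real (indicator {0..1} u *\<^sub>R \<rho> u))"
      using \<rho> unfolding set_integrable_def by (rule integrable_of_real)
    moreover have "(\<lambda>u. indicator {0..1} u *\<^sub>R character k (- \<eta> u) * complex_of_real (indicator {0..1} u *\<^sub>R \<rho> u))
        \<in> borel_measurable lebesgue"
      using borel_measurable_integrable[OF calculation] by measurable
    ultimately have "integrable lebesgue
        (\<lambda>u. indicator {0..1} u *\<^sub>R character k (- \<eta> u) * complex_of_real (indicator {0..1} u *\<^sub>R \<rho> u))"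
      by (rule Bochner_Integration.integrable_bound) (auto simp: norm_mult indicator_def)
    also have "(\<lambda>u. indicator {0..1} u *\<^sub>R character k (- \<eta> u) * complex_of_real (indicator {0..1} u *\<^sub>R \<rho> u)) =
        (\<lambda>u. indicator {0..1} u *\<^sub>R (character k (- \<eta> u) * complex_of_real (\<rho> u)))"
      by (auto simp: indicator_def)
    finally show ?thesis by (simp add: set_integrable_def)
  qed
  have expand: "complex_of_real (indicator {0..1} u *\<^sub>R (P (y - \<eta> u) * \<rho> u)) =
      (\<Sum>k\<in>I. c k * character k y * (indicator {0..1} u *\<^sub>R (character k (- \<eta> u) * complex_of_real (\<rho> u))))" for y u
  proof -
    have "complex_of_real (P (y - \<eta> u)) = (\<Sum>k\<in>I. c k * (character k y * character k (- \<eta> u)))"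
      using fun_cong[OF c(1), of "y - \<eta> u"] character_add[of _ y "- \<eta> u"] by simp
    then show ?thesis
      by (simp add: sum_distrib_left sum_distrib_right scaleR_conv_of_real mult_ac)
  qed
  have int_c: "integrable lebesgue (\<lambda>u. complex_of_real (indicator {0..1} u *\<^sub>R (P (y - \<eta> u) * \<rho> u)))" for y
    unfolding expand using int unfolding set_integrable_def
    by (intro Bochner_Integration.integrable_sum integrable_mult_right) auto
  then show "set_integrable lebesgue {0..1} (\<lambda>u. P (y - \<eta> u) * norm (torus_velocity \<eta> u))"
    unfolding complex_of_real_integrable_eq set_integrable_def \<rho>_def .
  \<comment> \<open>Fourier coefficients of the arc-length measure of the curve; \<open>J 0\<close>
    is the length.\<close>
  define J where "J k = (LINT u:{0..1}|lebesgue. character k (- \<eta> u) * complex_of_real (\<rho> u))" for k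
  have "complex_of_real (F y) = (\<Sum>k\<in>I. c k * J k * character k y)" for y
  proof -
    have "complex_of_real (F y) = (LINT u|lebesgue. complex_of_real (indicator {0..1} u *\<^sub>R (P (y - \<eta> u) * \<rho> u)))"
      unfolding F_def \<rho>_def set_lebesgue_integral_def by (rule integral_complex_of_real[symmetric])
    also have "\<dots> = (\<Sum>k\<in>I. c k * character k y * J k)"
      unfolding expand J_def set_lebesgue_integral_def using int unfolding set_integrable_def
      by (subst Bochner_Integration.integral_sum) (simp_all only: integrable_mult_right integral_mult_right_zero)
    finally show ?thesis by (simp add: mult_ac)
  qed
  moreover have "c 0 * J 0 = of_real (\<mu> * curve_length \<eta>)"
  proof -
    have "J 0 = (LINT u|lebesgue. complex_of_real (indicator {0..1} u *\<^sub>R \<rho> u))"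
      by (simp add: J_def set_lebesgue_integral_def scaleR_conv_of_real)
    also have "\<dots> = of_real (curve_length \<eta>)"
      unfolding curve_length_def \<rho>_def set_lebesgue_integral_def by (rule integral_complex_of_real)
    finally show ?thesis by (simp add: c(2))
  qed
  ultimately show "trig_mean n (\<lambda>y. complex_of_real (F y)) (of_real (\<mu> * curve_length \<eta>))"
    unfolding trig_mean_altdef I_def by (intro exI[of _ "\<lambda>k. c k * J k"]) auto
qed

text \<open>On the curve \<open>K \<le> F\<close>, and the weighted arc length has total mass
  \<open>L\<close>. Integration gives \<open>K * L\<close> on one side, while exactness evaluates
  the other to \<open>\<mu> * L * L\<close>.\<close>

lemma curve_length_ge_average:
  fixes \<eta> :: "real \<Rightarrow> real ^ 'd"
  assumes cont: "torus_continuous \<eta>" and exact: "curve_exact n \<eta> w"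
    and w: "\<And>t. t \<in> {0..1} \<Longrightarrow> w (\<eta> t) \<ge> 0"
    and P: "trig_mean n (\<lambda>x. complex_of_real (P x)) (of_real \<mu>)"
    and K: "\<And>t. t \<in> {0..1} \<Longrightarrow> K \<le> (LINT u:{0..1}|lebesgue. P (\<eta> t - \<eta> u) * norm (torus_velocity \<eta> u))"
    and "\<mu> > 0"
  shows "K \<le> \<mu> * curve_length \<eta>"
proof -
  define L where "L = curve_length \<eta>"
  define F where "F y = (LINT u:{0..1}|lebesgue. P (y - \<eta> u) * norm (torus_velocity \<eta> u))" for y
  define W where "W t = w (\<eta> t) * norm (torus_velocity \<eta> t)" for t
  have "L \<noteq> 0" unfolding L_def by (rule curve_exact_nonzero[OF exact])
  moreover have "L \<ge> 0"
    unfolding L_def curve_length_def set_lebesgue_integral_def by (rule Bochner_Integration.integral_nonneg) simp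
  ultimately have L: "L > 0" by simp
  have re: "curve_integral \<eta> (\<lambda>x. complex_of_real (f x)) = of_real (LINT t:{0..1}|lebesgue. f (\<eta> t) * norm (torus_velocity \<eta> t))" for f
    unfolding curve_integral_def set_lebesgue_integral_def integral_complex_of_real[symmetric]
    by (simp add: scaleR_conv_of_real)
  have W: "(LINT t:{0..1}|lebesgue. W t) = L"
    using curve_exact_nonzero(2)[OF exact] unfolding re L_def W_def by (simp only: of_real_eq_iff)
  have "trig_mean n (\<lambda>y. complex_of_real (F y)) (of_real (\<mu> * L))"
    unfolding F_def L_def using trig_mean_curve_average(1)[OF cont _ P] curve_exact_nonzero(1)[OF exact] .
  then have "1 / of_real L * curve_integral \<eta> (\<lambda>x. complex_of_real (F x) * of_real (w x)) = of_real (\<mu> * L)"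
    using exact unfolding curve_exact_def trig_mean_def L_def by metis
  then have "curve_integral \<eta> (\<lambda>x. complex_of_real (F x * w x)) = of_real (\<mu> * L * L)"
    using L by (simp add: field_simps)
  then have FW: "(LINT t:{0..1}|lebesgue. F (\<eta> t) * W t) = \<mu> * L * L"
    unfolding re W_def by (simp only: of_real_eq_iff mult.assoc)
  have intW: "set_integrable lebesgue {0..1} W"
    using W L not_integrable_integral_eq unfolding set_lebesgue_integral_def set_integrable_def by force
  show ?thesis
  \<comment> \<open>If the product were not integrable, its integral would be 0 by convention,
    contradicting \<open>\<mu> * L * L > 0\<close>.\<close>
  proof (cases "set_integrable lebesgue {0..1} (\<lambda>t. F (\<eta> t) * W t)")
    case True
    have "K * L = (LINT t:{0..1}|lebesgue. K * W t)"
      by (simp add: W)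
    also have "\<dots> \<le> (LINT t:{0..1}|lebesgue. F (\<eta> t) * W t)"
    proof (rule set_integral_mono[OF set_integrable_mult_right[OF intW] True])
      fix t :: real assume t: "t \<in> {0..1}"
      then show "K * W t \<le> F (\<eta> t) * W t"
        using K[OF t] w[OF t] unfolding F_def W_def by (intro mult_right_mono) auto
    qed
    also have "\<dots> = \<mu> * L * L" by (rule FW)
    finally show ?thesis using L by (simp add: L_def)
  next
    case False
    then have "\<mu> * L * L = 0"
      using FW not_integrable_integral_eq unfolding set_lebesgue_integral_def set_integrable_def by force
    then show ?thesis using L \<open>\<mu> > 0\<close> by simp
  qed
qed

text \<open>By closedness every curve point has arcs of length \<open>b\<close> on both sides, on
  which the kernel is at least \<open>2/3\<close>; the kernel has mean \<open>(1 / N) ^ d\<close>.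
  The assumption \<open>long\<close> keeps the two arcs from overlapping.\<close>

lemma curve_exact_length_ge:
  fixes \<eta> :: "real \<Rightarrow> real ^ 'd"
  assumes cont: "torus_continuous \<eta>" and diff: "torus_piecewise_differentiable \<eta>"
    and closed: "\<eta> 0 = \<eta> 1" and exact: "curve_exact n \<eta> w"
    and w: "\<And>t. t \<in> {0..1} \<Longrightarrow> w (\<eta> t) \<ge> 0"
    and long: "2 / ((real n + 1) * pi) \<le> curve_length \<eta>"
  shows "4 / (3 * pi) * (real n + 1) ^ (CARD('d) - 1) \<le> curve_length \<eta>"
proof -
  define N where "N = Suc n"
  define L where "L = curve_length \<eta>"
  define b where "b = 1 / (real N * pi)"
  define P where "P x = (\<Prod>i\<in>UNIV. fejer (\<lambda>_. 1 / real N) N (x $ i))" for x :: "real ^ 'd"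
  define \<rho> where "\<rho> = (\<lambda>u. norm (torus_velocity \<eta> u))"
  define A where "A u = integral {0..u} \<rho>" for u
  have N: "N \<ge> 1" "real N = real n + 1" by (simp_all add: N_def)
  have b: "b > 0" "2 * b \<le> L" using long by (simp_all add: b_def N L_def)
  have len: "curve_length \<eta> \<noteq> 0" by (rule curve_exact_nonzero[OF exact])
  obtain \<Theta> where \<Theta>: "\<And>t i. t \<in> {0..1} \<Longrightarrow> (\<Theta> t - \<eta> t) $ i \<in> \<int>"
    and disp: "\<And>s t. 0 \<le> s \<Longrightarrow> s \<le> t \<Longrightarrow> t \<le> 1 \<Longrightarrow> norm (\<Theta> t - \<Theta> s) \<le> A t - A s"
    using torus_curve_arc_length[OF cont diff len] unfolding A_def \<rho>_def by metis
  have A01: "A 0 = 0" "A 1 = L"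
    by (simp_all add: A_def L_def \<rho>_def curve_length_eq_integral[OF len])
  have mono: "A s \<le> A t" if "0 \<le> s" "s \<le> t" "t \<le> 1" for s t
    using disp[OF that] norm_ge_zero[of "\<Theta> t - \<Theta> s"] by linarith
  have disp': "norm (\<Theta> t - \<Theta> s) \<le> \<bar>A t - A s\<bar>" if "s \<in> {0..1}" "t \<in> {0..1}" for s t
    using disp[of s t] disp[of t s] that by (cases "s \<le> t") (auto simp: norm_minus_commute)
  have P_mean: "trig_mean n (\<lambda>x. complex_of_real (P x)) (of_real ((1 / real N) ^ CARD('d)))"
  proof -
    have "(\<Sum>j<N. (1 / real N)\<^sup>2) = 1 / real N"
      using N by (simp add: power2_eq_square)
    then show ?thesis
      using trig_mean_fejer[of N n "\<lambda>_. 1 / real N"] by (simp add: P_def N_def)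
  qed
  have P_nonneg: "P x \<ge> 0" for x
    unfolding P_def by (intro prod_nonneg) (simp add: fejer_nonneg)
  have P_cong: "P x = P y" if "\<And>i. (x - y) $ i \<in> \<int>" for x y
  proof -
    have "fejer (\<lambda>_. 1 / real N) N (x $ i) = fejer (\<lambda>_. 1 / real N) N (y $ i)" for i
    proof -
      have "cis (2 * pi * real j * x $ i) = cis (2 * pi * real j * y $ i)" for j
      proof -
        have "2 * pi * real j * x $ i = 2 * pi * (real j * (x - y) $ i) + 2 * pi * real j * y $ i"
          by (simp add: algebra_simps)
        moreover have "cis (2 * pi * (real j * (x - y) $ i)) = 1"
          using that by (intro cis_multiple_2pi Ints_mult) auto
        ultimately show ?thesis by (simp only: cis_mult[symmetric] mult_1)
      qed
      then show ?thesis by (simp only: fejer_def)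
    qed
    then show ?thesis by (simp add: P_def)
  qed
  \<comment> \<open>The lift of a closed curve need not close; its ends differ by a lattice
    vector.\<close>
  have period: "(\<Theta> 1 - \<Theta> 0) $ i \<in> \<int>" "(\<Theta> 0 - \<Theta> 1) $ i \<in> \<int>" for i
    using Ints_diff[OF \<Theta>[of 1 i] \<Theta>[of 0 i]] Ints_diff[OF \<Theta>[of 0 i] \<Theta>[of 1 i]] closed by simp_all
  \<comment> \<open>The alternatives are the direct arc between \<open>t\<close> and
    \<open>u\<close> and the arcs through the common endpoint in either direction.\<close>
  have near: "2/3 \<le> P (\<eta> t - \<eta> u)"
    if tu: "t \<in> {0..1}" "u \<in> {0..1}" and d: "\<bar>A u - A t\<bar> \<le> b \<or> A u \<le> A t + b - L \<or> A t - b + L \<le> A u" for t u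
  proof -
    have "\<exists>z. (\<forall>i. z $ i \<in> \<int>) \<and> norm (\<Theta> t - \<Theta> u + z) \<le> b"
      using d
    proof (elim disjE)
      assume "\<bar>A u - A t\<bar> \<le> b"
      then show ?thesis
        using disp'[OF tu(2,1)] by (intro exI[of _ 0]) auto
    next
      assume *: "A u \<le> A t + b - L"
      have "norm (\<Theta> t - \<Theta> u + (\<Theta> 0 - \<Theta> 1)) \<le> norm (\<Theta> 1 - \<Theta> t) + norm (\<Theta> u - \<Theta> 0)"
        using norm_triangle_ineq[of "\<Theta> 1 - \<Theta> t" "\<Theta> u - \<Theta> 0"] norm_minus_cancel[of "(\<Theta> 1 - \<Theta> t) + (\<Theta> u - \<Theta> 0)"]
        by (simp add: algebra_simps)
      also have "\<dots> \<le> b"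
        using disp[of t 1] disp[of 0 u] tu * A01 by auto
      finally show ?thesis
        using period(2) by (intro exI[of _ "\<Theta> 0 - \<Theta> 1"]) auto
    next
      assume *: "A t - b + L \<le> A u"
      have "norm (\<Theta> t - \<Theta> u + (\<Theta> 1 - \<Theta> 0)) \<le> norm (\<Theta> 1 - \<Theta> u) + norm (\<Theta> t - \<Theta> 0)"
        using norm_triangle_ineq[of "\<Theta> 1 - \<Theta> u" "\<Theta> t - \<Theta> 0"]
        by (simp add: algebra_simps)
      also have "\<dots> \<le> b"
        using disp[of u 1] disp[of 0 t] tu * A01 by auto
      finally show ?thesis
        using period(1) by (intro exI[of _ "\<Theta> 1 - \<Theta> 0"]) auto
    qed
    then obtain z where z: "\<And>i. z $ i \<in> \<int>" "norm (\<Theta> t - \<Theta> u + z) \<le> b" by blast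
    have "2/3 \<le> P (\<Theta> t - \<Theta> u + z)"
      unfolding P_def using z(2) by (intro fejer_prod_ge[OF N(1)]) (simp add: b_def)
    also have "\<dots> = P (\<eta> t - \<eta> u)"
    proof (rule P_cong)
      fix i
      have "(\<Theta> t - \<Theta> u + z - (\<eta> t - \<eta> u)) $ i = (\<Theta> t - \<eta> t) $ i - (\<Theta> u - \<eta> u) $ i + z $ i"
        by simp
      then show "(\<Theta> t - \<Theta> u + z - (\<eta> t - \<eta> u)) $ i \<in> \<int>"
        using \<Theta>[OF tu(1)] \<Theta>[OF tu(2)] z(1) by (simp only: Ints_add Ints_diff)
    qed
    finally show ?thesis .
  qed
  have \<rho>_int: "\<rho> integrable_on {0..1}"
    unfolding \<rho>_def using curve_length_nonzero_integrable[OF len] by (rule set_lebesgue_integral_eq_integral)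
  have "2/3 * (2 * b) \<le> (1 / real N) ^ CARD('d) * curve_length \<eta>"
  proof (rule curve_length_ge_average[OF cont exact w P_mean])
    fix t :: real assume t: "t \<in> {0..1}"
    have int: "set_integrable lebesgue {0..1} (\<lambda>u. P (\<eta> t - \<eta> u) * \<rho> u)"
      unfolding \<rho>_def by (rule trig_mean_curve_average(2)[OF cont len P_mean])
    have c: "0 \<le> A t" "A t \<le> L" using mono[of 0 t] mono[of t 1] t A01 by auto
    have window: "2/3 * ((\<beta> - \<alpha>) + (\<delta> - \<gamma>)) \<le> integral {0..1} (\<lambda>u. P (\<eta> t - \<eta> u) * \<rho> u)"
      if "0 \<le> \<alpha>" "\<alpha> \<le> \<beta>" "\<beta> \<le> \<gamma>" "\<gamma> \<le> \<delta>" "\<delta> \<le> L"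
        and "\<And>u. u \<in> {0..1} \<Longrightarrow> A u \<in> {\<alpha>..\<beta>} \<union> {\<gamma>..\<delta>} \<Longrightarrow>
          \<bar>A u - A t\<bar> \<le> b \<or> A u \<le> A t + b - L \<or> A t - b + L \<le> A u" for \<alpha> \<beta> \<gamma> \<delta>
    proof (rule integral_weighted_windows_ge[OF \<rho>_int])
      show "(\<lambda>u. P (\<eta> t - \<eta> u) * \<rho> u) integrable_on {0..1}"
        using int by (rule set_lebesgue_integral_eq_integral)
    qed (use that A01(2) near[OF t] P_nonneg in \<open>auto simp: \<rho>_def A_def\<close>)
    have "2/3 * (2 * b) \<le> integral {0..1} (\<lambda>u. P (\<eta> t - \<eta> u) * \<rho> u)"
    proof -
      \<comment> \<open>If \<open>t\<close> is within arc length \<open>b\<close> of an end, part of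
        the arc wraps around and occupies a window at the other end.\<close>
      consider "b \<le> A t" "A t \<le> L - b" | "A t < b" | "L - b < A t" by linarith
      then show ?thesis
      proof cases
        case 1
        have "2/3 * ((A t - (A t - b)) + (A t + b - A t)) \<le> integral {0..1} (\<lambda>u. P (\<eta> t - \<eta> u) * \<rho> u)"
          by (rule window) (use 1 b(1) in \<open>auto simp: abs_le_iff\<close>)
        then show ?thesis by simp
      next
        case 2
        have "2/3 * ((A t + b - 0) + (L - (L + A t - b))) \<le> integral {0..1} (\<lambda>u. P (\<eta> t - \<eta> u) * \<rho> u)"
          by (rule window) (use 2 b c in \<open>auto simp: abs_le_iff\<close>)
        then show ?thesis by simp
      next
        case 3
        have "2/3 * ((A t + b - L - 0) + (L - (A t - b))) \<le> integral {0..1} (\<lambda>u. P (\<eta> t - \<eta> u) * \<rho> u)"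
          by (rule window) (use 3 b c in \<open>auto simp: abs_le_iff\<close>)
        then show ?thesis by simp
      qed
    qed
    also have "\<dots> = (LINT u:{0..1}|lebesgue. P (\<eta> t - \<eta> u) * \<rho> u)"
      using int by (rule set_lebesgue_integral_eq_integral(2)[symmetric])
    finally show "2/3 * (2 * b) \<le> (LINT u:{0..1}|lebesgue. P (\<eta> t - \<eta> u) * norm (torus_velocity \<eta> u))"
      by (simp only: \<rho>_def)
  qed (use N in auto)
  then have "4 / (3 * pi) * (real N ^ CARD('d) / real N) \<le> L"
    using N by (simp add: L_def b_def field_simps)
  moreover have "real N ^ CARD('d) / real N = real N ^ (CARD('d) - 1)"
    using power_minus_mult[of "CARD('d)" "real N"] N by (simp add: field_simps)
  ultimately show ?thesis by (simp only: N(2) L_def)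
qed

text \<open>The covering hypothesis gives length at least \<open>3/4\<close>. This settles dimension
  1; in higher dimension it supplies \<open>long\<close> for the kernel estimate.\<close>

lemma curve_length_lower_bound:
  fixes \<eta> :: "real \<Rightarrow> real ^ 'd"
  assumes n: "n \<ge> 1" and cont: "torus_continuous \<eta>" and diff: "torus_piecewise_differentiable \<eta>"
    and closed: "\<eta> 0 = \<eta> 1" and exact: "curve_exact n \<eta> w"
    and w: "\<And>t. t \<in> {0..1} \<Longrightarrow> w (\<eta> t) \<ge> 0"
    and cover: "covering_radius (\<eta> ` {0..1}) \<le> 1/8"
  shows "0.94 / sqrt (2 * real CARD('d) + 1) * (real n + 1) ^ (CARD('d) - 1) \<le> curve_length \<eta>"
proof -
  have len: "3/4 \<le> curve_length \<eta>"
    using curve_length_ge_covering[OF cont diff curve_exact_nonzero(1)[OF exact]] cover by simp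
  show ?thesis
  proof (cases "CARD('d) = 1")
    case True
    have "5/3 \<le> sqrt 3" by (rule real_le_rsqrt) (simp add: power2_eq_square)
    then have "0.94 / sqrt 3 \<le> 3/4" by (simp add: field_simps)
    then show ?thesis using True len by simp
  next
    case False
    have "0 < CARD('d)" by simp
    with False have d: "CARD('d) \<ge> 2" by linarith
    \<comment> \<open>The constant decreases with the dimension, so dimension 2 decides:
      \<open>0.94 / sqrt 5\<close> is about 0.4204 and \<open>4 / (3 * pi)\<close> about
      0.4244.\<close>
    have "2.236 \<le> sqrt 5" by (rule real_le_rsqrt) (simp add: power2_eq_square)
    also have "sqrt 5 \<le> sqrt (2 * real CARD('d) + 1)" using d by simp
    finally have "0.94 / sqrt (2 * real CARD('d) + 1) \<le> 0.94 / 2.236"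
      by (intro divide_left_mono) auto
    also have "\<dots> \<le> 4 / (3 * pi)"
      using pi_approx(2) by (simp add: field_simps)
    finally have const: "0.94 / sqrt (2 * real CARD('d) + 1) \<le> 4 / (3 * pi)" .
    have "2 / ((real n + 1) * pi) \<le> 3/4"
    proof -
      have "2 * 2 \<le> (real n + 1) * pi" using n pi_ge_two by (intro mult_mono) auto
      then show ?thesis by (simp add: field_simps)
    qed
    then have "2 / ((real n + 1) * pi) \<le> curve_length \<eta>" using len by linarith
    from curve_exact_length_ge[OF cont diff closed exact w this]
    have "4 / (3 * pi) * (real n + 1) ^ (CARD('d) - 1) \<le> curve_length \<eta>" .
    moreover have "0.94 / sqrt (2 * real CARD('d) + 1) * (real n + 1) ^ (CARD('d) - 1) \<le>
        4 / (3 * pi) * (real n + 1) ^ (CARD('d) - 1)"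
      using const by (rule mult_right_mono) simp
    ultimately show ?thesis by linarith
  qed
qed

section \<open>Comparison of the bounds, and the theorem\<close>

text \<open>The first entry of the maximum \<open>C\<close> is the ratio of the covering bounds; the
  second is the ratio of the length bounds after \<open>2 * m + 1 \<le> 2 * (m + 1)\<close>.\<close>

lemma quasi_optimality_constant:
  fixes d :: nat
  assumes "d \<ge> 1"
  shows "\<exists>C>0. \<forall>m\<ge>1.
      2 ^ (d - 1) * (1 / (real m + 1)) \<le> C * (1/4 * (1 / (real m + 1))) \<and>
      3 / sqrt 8 * (2 * real m + 1) ^ (d - 1) \<le> C * (0.94 / sqrt (2 * real d + 1) * (real m + 1) ^ (d - 1))"
proof -
  define c where "c = 0.94 / sqrt (2 * real d + 1)"
  have c: "c > 0" by (simp add: c_def)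
  define C where "C = max (2 ^ (d + 1)) (3 / sqrt 8 * 2 ^ (d - 1) / c)"
  have "C > 0" unfolding C_def by (rule less_le_trans[OF _ max.cobounded1]) simp
  moreover have "2 ^ (d - 1) * (1 / (real m + 1)) \<le> C * (1/4 * (1 / (real m + 1)))" for m
  proof -
    have pow: "(2 :: real) ^ (d + 1) = 4 * 2 ^ (d - 1)"
      using assms power_minus_mult[of d "2 :: real"] by simp
    have "2 ^ (d - 1) * q = 2 ^ (d + 1) * (1/4 * q)" for q :: real
      unfolding pow by simp
    then have "2 ^ (d - 1) * (1 / (real m + 1)) = 2 ^ (d + 1) * (1/4 * (1 / (real m + 1)))" .
    also have "\<dots> \<le> C * (1/4 * (1 / (real m + 1)))"
      unfolding C_def by (intro mult_right_mono max.cobounded1) simp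
    finally show ?thesis .
  qed
  moreover have "3 / sqrt 8 * (2 * real m + 1) ^ (d - 1) \<le> C * (c * (real m + 1) ^ (d - 1))" for m
  proof -
    have "3 / sqrt 8 * (2 * real m + 1) ^ (d - 1) \<le> 3 / sqrt 8 * (2 * (real m + 1)) ^ (d - 1)"
      by (intro mult_left_mono power_mono) auto
    also have "\<dots> = 3 / sqrt 8 * 2 ^ (d - 1) / c * (c * (real m + 1) ^ (d - 1))"
      unfolding power_mult_distrib using c by simp
    also have "\<dots> \<le> C * (c * (real m + 1) ^ (d - 1))"
      unfolding C_def using c by (intro mult_right_mono max.cobounded2) simp
    finally show ?thesis .
  qed
  ultimately show ?thesis unfolding c_def by blast
qed

theorem corollary4p4:
  fixes n :: nat and \<gamma> :: "nat \<Rightarrow> real \<Rightarrow> real ^ 'd::{finite, linorder}"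
  assumes "n \<ge> 1" and "even n"
  defines "\<gamma> \<equiv> gamma_curve"
  shows
    "\<comment> \<open>(i)\<close>
     (\<forall>f\<in>trig_polys n.
        1 / of_real (curve_length (\<gamma> n)) * curve_integral (\<gamma> n) f = torus_integral f) \<and>
     (CARD('d) \<ge> 2 \<longrightarrow> covering_radius (\<gamma> n ` {0..1}) \<ge> 1/4 * (1 / (real n + 1))) \<and>
     curve_length (\<gamma> n) \<le> 3 / sqrt 8 * (2 * real n + 1) ^ (CARD('d) - 1) \<and>
     \<comment> \<open>(ii), necessary bounds\<close>
     (\<forall>N (x :: nat \<Rightarrow> real ^ 'd::{finite, linorder}) w.
        (\<forall>j<N. x j \<in> torus \<and> w j > 0) \<and> quadrature_exact n N x w \<longrightarrow>
        covering_radius (x ` {..<N}) \<le> 2 ^ (CARD('d) - 1) * (1 / (real n + 1))) \<and>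
     (\<forall>\<eta> :: real \<Rightarrow> real ^ 'd::{finite, linorder}.
        \<eta> ` {0..1} \<subseteq> torus \<and> torus_continuous \<eta> \<and> torus_piecewise_differentiable \<eta> \<and>
        \<eta> 0 = \<eta> 1 \<and> finite (self_intersections \<eta>) \<and> covering_radius (\<eta> ` {0..1}) \<le> 1/8 \<and>
        (\<exists>w. (\<forall>p\<in>\<eta> ` {0..1}. w p \<ge> 0) \<and> curve_exact n \<eta> w) \<longrightarrow>
        curve_length \<eta> \<ge> 0.94 / sqrt (2 * real CARD('d) + 1) * (real n + 1) ^ (CARD('d) - 1)) \<and>
     \<comment> \<open>(ii), a single constant for all even m: it depends on the dimension only\<close>
     (\<exists>C>0. \<forall>m\<ge>1. even m \<longrightarrow>
        (CARD('d) \<ge> 2 \<longrightarrow>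
           2 ^ (CARD('d) - 1) * (1 / (real m + 1)) \<le> C * covering_radius (\<gamma> m ` {0..1})) \<and>
        curve_length (\<gamma> m) \<le>
          C * (0.94 / sqrt (2 * real CARD('d) + 1) * (real m + 1) ^ (CARD('d) - 1)))"
proof (intro conjI allI impI ballI)
  fix f :: "real ^ 'd::{finite, linorder} \<Rightarrow> complex" assume "f \<in> trig_polys n"
  then show "1 / of_real (curve_length (\<gamma> n)) * curve_integral (\<gamma> n) f = torus_integral f"
    unfolding \<gamma>_def by (rule gamma_curve_exact)
next
  assume "CARD('d) \<ge> 2"
  then show "covering_radius (\<gamma> n ` {0..1}) \<ge> 1/4 * (1 / (real n + 1))"
    unfolding \<gamma>_def by (rule covering_radius_gamma_ge)
next
  show "curve_length (\<gamma> n) \<le> 3 / sqrt 8 * (2 * real n + 1) ^ (CARD('d) - 1)"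
    unfolding \<gamma>_def curve_length_gamma by (rule norm_gamma_velocity_le[OF assms(1)])
next
  fix N and x :: "nat \<Rightarrow> real ^ 'd::{finite, linorder}" and w
  assume "(\<forall>j<N. x j \<in> torus \<and> w j > 0) \<and> quadrature_exact n N x w"
  then show "covering_radius (x ` {..<N}) \<le> 2 ^ (CARD('d) - 1) * (1 / (real n + 1))"
    using quadrature_covering_radius[OF assms(1)] by blast
next
  fix \<eta> :: "real \<Rightarrow> real ^ 'd::{finite, linorder}"
  assume \<eta>: "\<eta> ` {0..1} \<subseteq> torus \<and> torus_continuous \<eta> \<and> torus_piecewise_differentiable \<eta> \<and>
    \<eta> 0 = \<eta> 1 \<and> finite (self_intersections \<eta>) \<and> covering_radius (\<eta> ` {0..1}) \<le> 1/8 \<and>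
    (\<exists>w. (\<forall>p\<in>\<eta> ` {0..1}. w p \<ge> 0) \<and> curve_exact n \<eta> w)"
  then obtain w where "\<forall>p\<in>\<eta> ` {0..1}. w p \<ge> 0" "curve_exact n \<eta> w" by blast
  with \<eta> show "curve_length \<eta> \<ge> 0.94 / sqrt (2 * real CARD('d) + 1) * (real n + 1) ^ (CARD('d) - 1)"
    by (intro curve_length_lower_bound[OF assms(1)]) auto
next
  have "CARD('d) \<ge> 1" by (simp add: Suc_le_eq)
  \<comment> \<open>\<open>C\<close> is fixed from the dimension before \<open>m\<close> is
    introduced, so one constant serves all \<open>m\<close>.\<close>
  from quasi_optimality_constant[OF this] obtain C where C: "C > 0"
    "\<And>m. m \<ge> 1 \<Longrightarrow> 2 ^ (CARD('d) - 1) * (1 / (real m + 1)) \<le> C * (1/4 * (1 / (real m + 1)))"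
    "\<And>m. m \<ge> 1 \<Longrightarrow> 3 / sqrt 8 * (2 * real m + 1) ^ (CARD('d) - 1) \<le>
      C * (0.94 / sqrt (2 * real CARD('d) + 1) * (real m + 1) ^ (CARD('d) - 1))"
    by blast
  show "\<exists>C>0. \<forall>m\<ge>1. even m \<longrightarrow>
      (CARD('d) \<ge> 2 \<longrightarrow>
         2 ^ (CARD('d) - 1) * (1 / (real m + 1)) \<le> C * covering_radius (\<gamma> m ` {0..1})) \<and>
      curve_length (\<gamma> m) \<le>
        C * (0.94 / sqrt (2 * real CARD('d) + 1) * (real m + 1) ^ (CARD('d) - 1))"
  proof (intro exI[of _ C] conjI allI impI)
    fix m :: nat assume m: "m \<ge> 1"
    show "curve_length (\<gamma> m) \<le> C * (0.94 / sqrt (2 * real CARD('d) + 1) * (real m + 1) ^ (CARD('d) - 1))"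
      unfolding \<gamma>_def curve_length_gamma by (rule order_trans[OF norm_gamma_velocity_le[OF m] C(3)[OF m]])
    assume "CARD('d) \<ge> 2"
    then have "C * (1/4 * (1 / (real m + 1))) \<le> C * covering_radius (\<gamma> m ` {0..1})"
      unfolding \<gamma>_def using C(1) by (intro mult_left_mono covering_radius_gamma_ge) auto
    with C(2)[OF m] show "2 ^ (CARD('d) - 1) * (1 / (real m + 1)) \<le> C * covering_radius (\<gamma> m ` {0..1})"
      by linarith
  qed (rule C(1))
qed

end
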